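(* Let $r>1$, let $n\ge1$, and let $(T_1,\dots,T_n)$ be a doubly commuting tuple of invertible bounded operators on a complex Hilbert space with $\|T_j\|\le r$ and $\|T_j^{-1}\|\le r$ for $1\le j\le n$. Then $$\|g(T_1,\dots,T_n)\|\le\left(\frac{3r^2-1}{r^2-1}\right)^n\|g\|_{\infty,\overline{\mathbb{A}}_r^n}$$ for all $g\in\mathrm{Rat}(\overline{\mathbb{A}}_r^n)$.
   Context: $\mathbb{A}_r=\{z\in\mathbb{C}: r^{-1}<|z|<r\}$, $\overline{\mathbb{A}}_r$ is its closure, and $\overline{\mathbb{A}}_r^n$ is the $n$-fold Cartesian product of $\overline{\mathbb{A}}_r$. An operator tuple $(T_1,\dots,T_n)$ is doubly commuting if $T_iT_j=T_jT_i$ and $T_iT_j^*=T_j^*T_i$ for all $1\le i,j\le n$ with $i\neq j$. For a compact set $X\subseteq\mathbb{C}^n$, $\mathrm{Rat}(X)$ is the algebra of rational functions $p/q$ with singularities outside $X$ (i.e. $q$ has no zeros in $X$), and $\|g\|_{\infty,X}=\sup_{X}|g|$. For a commuting tuple $\underline T$ with Taylor joint spectrum in $X$ and $g=p/q\in\mathrm{Rat}(X)$, $g(\underline T)=p(\underline T)q(\underline T)^{-1}$. The hypotheses imply that the Taylor joint spectrum of $(T_1,\dots,T_n)$ lies in $\overline{\mathbb{A}}_r^n$. *)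

theory Defs
  imports "HOL-Analysis.Analysis" "HOL-Library.Poly_Mapping"
begin

text \<open>Complex Hilbert spaces. The complex structure extends the real one of
  \<^class>\<open>banach\<close>, and the norm is the one induced by the inner product, which is
  conjugate-linear in the first and linear in the second argument.\<close>

class complex_hilbert = banach +
  fixes scaleC :: "complex \<Rightarrow> 'a \<Rightarrow> 'a"  (infixr "*\<^sub>C" 75)
    and cinner :: "'a \<Rightarrow> 'a \<Rightarrow> complex"
  assumes scaleC_of_real: "complex_of_real t *\<^sub>C x = t *\<^sub>R x"
    and scaleC_add_right: "c *\<^sub>C (x + y) = c *\<^sub>C x + c *\<^sub>C y"
    and scaleC_add_left: "(c + d) *\<^sub>C x = c *\<^sub>C x + d *\<^sub>C x"
    and scaleC_scaleC: "c *\<^sub>C d *\<^sub>C x = (c * d) *\<^sub>C x"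
    and cinner_commute: "cinner x y = cnj (cinner y x)"
    and cinner_add_right: "cinner x (y + z) = cinner x y + cinner x z"
    and cinner_scaleC_right: "cinner x (c *\<^sub>C y) = c * cinner x y"
    and norm_cinner: "complex_of_real ((norm x)\<^sup>2) = cinner x x"

text \<open>Operators are plain functions; their norm is \<^const>\<open>onorm\<close>, their product is
  composition, and the inverse of a bijective operator is \<^term>\<open>inv T\<close>.\<close>

definition bounded_clinear :: "('a::complex_hilbert \<Rightarrow> 'a) \<Rightarrow> bool" where
  "bounded_clinear T \<longleftrightarrow> bounded_linear T \<and> (\<forall>c x. T (c *\<^sub>C x) = c *\<^sub>C T x)"

definition invertible_op :: "('a::complex_hilbert \<Rightarrow> 'a) \<Rightarrow> bool" where
  "invertible_op T \<longleftrightarrow> bounded_clinear T \<and> bij T \<and> bounded_clinear (inv T)"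

text \<open>For \<^term>\<open>bounded_clinear T\<close> such an \<open>S\<close> exists and is unique (Riesz).\<close>

definition cadjoint :: "('a::complex_hilbert \<Rightarrow> 'a) \<Rightarrow> 'a \<Rightarrow> 'a" where
  "cadjoint T = (THE S. \<forall>x y. cinner (T x) y = cinner x (S y))"

text \<open>An \<open>n\<close>-tuple of operators is a function on \<^typ>\<open>nat\<close> of which only the values at
  indices below \<open>n\<close> matter.\<close>

definition doubly_commuting :: "nat \<Rightarrow> (nat \<Rightarrow> 'a::complex_hilbert \<Rightarrow> 'a) \<Rightarrow> bool" where
  "doubly_commuting n T \<longleftrightarrow>
     (\<forall>i<n. \<forall>j<n. i \<noteq> j \<longrightarrow>
        T i \<circ> T j = T j \<circ> T i \<and> T i \<circ> cadjoint (T j) = cadjoint (T j) \<circ> T i)"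

definition annulus :: "real \<Rightarrow> complex set" where
  "annulus r = {z. inverse r < cmod z \<and> cmod z < r}"

definition closed_polyannulus :: "nat \<Rightarrow> real \<Rightarrow> (nat \<Rightarrow> complex) set" where
  "closed_polyannulus n r = (\<Pi>\<^sub>E j\<in>{..<n}. closure (annulus r))"

text \<open>Complex polynomials in variables indexed by \<^typ>\<open>nat\<close>: a finitely supported family of
  coefficients, indexed by finitely supported exponent vectors.\<close>

type_synonym cpoly = "(nat \<Rightarrow>\<^sub>0 nat) \<Rightarrow>\<^sub>0 complex"

definition polys :: "nat \<Rightarrow> cpoly set" where
  "polys n = {p. \<forall>m \<in> Poly_Mapping.keys p. Poly_Mapping.keys m \<subseteq> {..<n}}"

definition poly_eval :: "nat \<Rightarrow> cpoly \<Rightarrow> (nat \<Rightarrow> complex) \<Rightarrow> complex" where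
  "poly_eval n p z =
     (\<Sum>m\<in>Poly_Mapping.keys p.
        Poly_Mapping.lookup p m * (\<Prod>j<n. z j ^ Poly_Mapping.lookup m j))"

text \<open>The operator monomial \<open>T\<^sub>0\<^bsup>m 0\<^esup> \<circ> \<dots> \<circ> T\<^sub>k\<^sub>-\<^sub>1\<^bsup>m (k-1)\<^esup>\<close>; the order of the factors is
  immaterial for commuting tuples.\<close>

primrec monom_op ::
    "nat \<Rightarrow> (nat \<Rightarrow>\<^sub>0 nat) \<Rightarrow> (nat \<Rightarrow> 'a::complex_hilbert \<Rightarrow> 'a) \<Rightarrow> 'a \<Rightarrow> 'a" where
  "monom_op 0 m T = id"
| "monom_op (Suc k) m T = monom_op k m T \<circ> (T k ^^ Poly_Mapping.lookup m k)"

definition poly_op :: "nat \<Rightarrow> cpoly \<Rightarrow> (nat \<Rightarrow> 'a::complex_hilbert \<Rightarrow> 'a) \<Rightarrow> 'a \<Rightarrow> 'a" where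
  "poly_op n p T x =
     (\<Sum>m\<in>Poly_Mapping.keys p. Poly_Mapping.lookup p m *\<^sub>C monom_op n m T x)"

text \<open>A rational function \<open>p / q\<close> is given by the pair \<open>(p, q)\<close>.\<close>

definition Rat_on :: "nat \<Rightarrow> (nat \<Rightarrow> complex) set \<Rightarrow> (cpoly \<times> cpoly) set" where
  "Rat_on n X = {(p, q). p \<in> polys n \<and> q \<in> polys n \<and> (\<forall>z\<in>X. poly_eval n q z \<noteq> 0)}"

definition rat_eval :: "nat \<Rightarrow> cpoly \<times> cpoly \<Rightarrow> (nat \<Rightarrow> complex) \<Rightarrow> complex" where
  "rat_eval n g z = poly_eval n (fst g) z / poly_eval n (snd g) z"

text \<open>The value \<open>g(T) = p(T) q(T)\<^sup>-\<^sup>1\<close>, meaningful only when \<open>q(T)\<close> is invertible.\<close>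

definition rat_op ::
    "nat \<Rightarrow> cpoly \<times> cpoly \<Rightarrow> (nat \<Rightarrow> 'a::complex_hilbert \<Rightarrow> 'a) \<Rightarrow> 'a \<Rightarrow> 'a" where
  "rat_op n g T = poly_op n (fst g) T \<circ> inv (poly_op n (snd g) T)"

definition sup_norm :: "'b set \<Rightarrow> ('b \<Rightarrow> complex) \<Rightarrow> real" where
  "sup_norm X f = (SUP z\<in>X. cmod (f z))"

end

theory Submission
  imports Defs "HOL-Complex_Analysis.Complex_Analysis"
begin

text \<open>For one operator \<open>T\<close> with \<open>\<parallel>T\<parallel>, \<parallel>T\<inverse>\<parallel> \<le> r\<close> and a Laurent polynomial
  \<open>g(z) = \<Sum>k. a k * z\<^sup>k\<close> bounded by \<open>K\<close> on the circles \<open>|z| = r\<close> and \<open>|z| = 1/r\<close>, apply von Neumann's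
  inequality on each circle in its harmonic form: integrating \<open>g\<close> against the positive operator-valued
  Poisson kernel of the contraction \<open>T/r\<close> gives
  \<open>\<parallel>(\<Sum>k\<ge>0. a k * T\<^sup>k) + (\<Sum>k>0. r\<^sup>-\<^sup>2\<^sup>k * a (-k) * (T*)\<^sup>k)\<parallel> \<le> K\<close>, and \<open>T\<inverse>/r\<close> gives
  the mirror image. The sum of both operators is \<open>g(T)\<close> plus \<open>a 0\<close> plus the correction terms. As
  \<open>|a (-k)| \<le> K r\<^sup>-\<^sup>k\<close> (mean over \<open>|z| = 1/r\<close>) and \<open>|a k| \<le> K r\<^sup>-\<^sup>k\<close> (mean over \<open>|z| = r\<close>), the
  corrections are dominated by a geometric series, and altogether
  \<open>\<parallel>g(T)\<parallel> \<le> (2 + 1 + 2 / (r\<^sup>2 - 1)) K = (3 r\<^sup>2 - 1) / (r\<^sup>2 - 1) K\<close>.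

  The argument still works when the coefficients \<open>a k\<close> are operators commuting with \<open>T\<close> and its
  adjoint; this is \<open>annulus_operator_Laurent_bound\<close>. The positivity it needs is that the defect form
  \<open>\<langle>u, v\<rangle> - \<langle>T u, T v\<rangle>\<close> of a contraction \<open>T\<close> is respected by such operators
  (\<open>energy_contraction\<close>). For Laurent polynomials in a doubly commuting tuple the estimate then
  follows by induction on the number of variables: the coefficients of the powers of the last variable
  are Laurent polynomials in the other operators, so one factor of the constant is gained per
  variable (\<open>Laurent_calc_bound\<close>).

  To pass to \<open>g = p/q\<close>, the function \<open>1/q\<close> is approximated uniformly on the closed polyannulus by
  Laurent polynomials \<open>h\<close>; this is possible because \<open>q\<close> has no zeros on a slightly larger polyannulus
  (\<open>approximate_reciprocal\<close>). The estimate for \<open>1 - q h\<close> makes \<open>q(T) h(T)\<close> close to the identity,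
  which gives the invertibility of \<open>q(T)\<close>, and the estimate for \<open>p h\<close>, which is close to \<open>p/q\<close>,
  gives the norm bound in the limit.

  Poisson kernels are replaced by Fejer means and integrals over circles by averages over roots of
  unity, so that all operators involved are finite sums.\<close>

section \<open>Complex Hilbert spaces and adjoints\<close>

lemma scaleC_one [simp]: "1 *\<^sub>C (x::'a::complex_hilbert) = x"
  using scaleC_of_real[of 1 x] by simp

lemma scaleC_zero_left [simp]: "0 *\<^sub>C (x::'a::complex_hilbert) = 0"
  using scaleC_of_real[of 0 x] by simp

lemma scaleC_minus_left: "(- c) *\<^sub>C (x::'a::complex_hilbert) = - (c *\<^sub>C x)"
proof -
  have "(- c) *\<^sub>C x = (of_real (-1) * c) *\<^sub>C x" by simp
  also have "\<dots> = - (c *\<^sub>C x)" by (simp only: scaleC_scaleC[symmetric] scaleC_of_real) simp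
  finally show ?thesis .
qed

lemma scaleC_zero_right [simp]: "c *\<^sub>C (0::'a::complex_hilbert) = 0"
  using scaleC_add_right[of c 0 "0::'a"] by simp

lemma scaleC_sum_right: "c *\<^sub>C (\<Sum>i\<in>I. f i) = (\<Sum>i\<in>I. c *\<^sub>C (f i::'a::complex_hilbert))"
  by (induction I rule: infinite_finite_induct) (auto simp: scaleC_add_right)

lemma cinner_add_left: "cinner (x + y) z = cinner x z + cinner (y::'a::complex_hilbert) z"
  by (metis cinner_add_right cinner_commute complex_cnj_add)

lemma cinner_scaleC_left: "cinner (c *\<^sub>C x) y = cnj c * cinner (x::'a::complex_hilbert) y"
  by (metis cinner_scaleC_right cinner_commute complex_cnj_mult)

lemma cinner_zero_right [simp]: "cinner x (0::'a::complex_hilbert) = 0"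
  using cinner_add_right[of x 0 0] by simp

lemma cinner_zero_left [simp]: "cinner (0::'a::complex_hilbert) x = 0"
  using cinner_add_left[of 0 0 x] by simp

lemma cinner_minus_right: "cinner x (- y::'a::complex_hilbert) = - cinner x y"
  using cinner_add_right[of x y "-y"] by (simp add: eq_neg_iff_add_eq_0 add.commute)

lemma cinner_minus_left: "cinner (- x::'a::complex_hilbert) y = - cinner x y"
  using cinner_add_left[of x "-x" y] by (simp add: eq_neg_iff_add_eq_0 add.commute)

lemma cinner_diff_right: "cinner x (y - z::'a::complex_hilbert) = cinner x y - cinner x z"
  using cinner_add_right[of x y "-z"] by (simp add: cinner_minus_right)

lemma cinner_diff_left: "cinner (x - y::'a::complex_hilbert) z = cinner x z - cinner y z"
  using cinner_add_left[of x "-y" z] by (simp add: cinner_minus_left)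

lemma cinner_sum_right: "cinner x (\<Sum>i\<in>I. f i) = (\<Sum>i\<in>I. cinner (x::'a::complex_hilbert) (f i))"
  by (induction I rule: infinite_finite_induct) (auto simp: cinner_add_right)

lemma cinner_sum_left: "cinner (\<Sum>i\<in>I. f i) x = (\<Sum>i\<in>I. cinner (f i::'a::complex_hilbert) x)"
  by (induction I rule: infinite_finite_induct) (auto simp: cinner_add_left)

lemma norm_sq_cinner: "(norm (x::'a::complex_hilbert))\<^sup>2 = Re (cinner x x)"
  by (simp flip: norm_cinner)

lemma Re_cinner_commute: "Re (cinner x y) = Re (cinner (y::'a::complex_hilbert) x)"
  by (subst cinner_commute) simp

lemma norm_sq_add:
  "(norm (x + y::'a::complex_hilbert))\<^sup>2 = (norm x)\<^sup>2 + 2 * Re (cinner x y) + (norm y)\<^sup>2"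
  using Re_cinner_commute[of x y]
  by (simp add: norm_sq_cinner cinner_add_left cinner_add_right)

lemma norm_sq_diff:
  "(norm (x - y::'a::complex_hilbert))\<^sup>2 = (norm x)\<^sup>2 - 2 * Re (cinner x y) + (norm y)\<^sup>2"
  using Re_cinner_commute[of x y]
  by (simp add: norm_sq_cinner cinner_diff_left cinner_diff_right)

lemma norm_scaleC: "norm (c *\<^sub>C x::'a::complex_hilbert) = cmod c * norm x"
proof -
  have "(norm (c *\<^sub>C x))\<^sup>2 = Re ((c * cnj c) * cinner x x)"
    by (simp add: norm_sq_cinner cinner_scaleC_left cinner_scaleC_right mult_ac)
  also have "\<dots> = (cmod c * norm x)\<^sup>2"
    by (simp add: complex_norm_square[symmetric] norm_cinner[symmetric] power_mult_distrib)
  finally show ?thesis by (simp add: power2_eq_iff_nonneg)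
qed

lemma unimodular_phase:
  obtains c where "cmod c = 1" "complex_of_real (cmod z) = c * z"
proof (cases "z = 0")
  case True then show ?thesis using that[of 1] by simp
next
  case False
  have "complex_of_real (cmod z) = (cnj z / cmod z) * z"
    using False by (simp add: field_simps complex_norm_square[symmetric] power2_eq_square mult.commute)
  then show ?thesis using False that[of "cnj z / cmod z"] by (simp add: norm_divide)
qed

text \<open>After a rotation of \<open>y\<close> that makes the inner product real, this is \<open>\<parallel>x - y\<parallel>\<^sup>2 \<ge> 0\<close>.\<close>

lemma Cauchy_Schwarz_AM_GM: "2 * cmod (cinner x y) \<le> (norm x)\<^sup>2 + (norm (y::'a::complex_hilbert))\<^sup>2"
proof -
  obtain c where c: "cmod c = 1" "complex_of_real (cmod (cinner x y)) = cinner x (c *\<^sub>C y)"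
    using unimodular_phase[of "cinner x y"] by (metis cinner_scaleC_right)
  have "0 \<le> (norm (x - c *\<^sub>C y))\<^sup>2" by simp
  also have "\<dots> = (norm x)\<^sup>2 - 2 * cmod (cinner x y) + (norm y)\<^sup>2"
    using c by (simp add: norm_sq_diff norm_scaleC flip: c(2))
  finally show ?thesis by simp
qed

lemma Cauchy_Schwarz_cinner: "cmod (cinner x y) \<le> norm x * norm (y::'a::complex_hilbert)"
proof (cases "x = 0 \<or> y = 0")
  case False
  have "2 * cmod (cinner (x /\<^sub>R norm x) (y /\<^sub>R norm y)) \<le> 1 + 1"
    using Cauchy_Schwarz_AM_GM[of "x /\<^sub>R norm x" "y /\<^sub>R norm y"] False by simp
  also have "cmod (cinner (x /\<^sub>R norm x) (y /\<^sub>R norm y)) = cmod (cinner x y) / (norm x * norm y)"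
    by (simp flip: scaleC_of_real add: cinner_scaleC_left cinner_scaleC_right norm_mult norm_divide norm_inverse field_simps)
  finally show ?thesis using False by (simp add: field_simps)
qed auto

lemma parallelogram:
  "(norm (x + y::'a::complex_hilbert))\<^sup>2 + (norm (x - y))\<^sup>2 = 2 * (norm x)\<^sup>2 + 2 * (norm y)\<^sup>2"
  by (simp add: norm_sq_add norm_sq_diff)

lemma norm_le_of_cinner:
  fixes z :: "'a::complex_hilbert"
  assumes "\<And>y. cmod (cinner y z) \<le> c * norm y" and "0 \<le> c"
  shows "norm z \<le> c"
proof (cases "z = 0")
  case False
  have "norm z * norm z = cmod (cinner z z)"
    by (simp flip: norm_cinner add: power2_eq_square norm_mult)
  also have "\<dots> \<le> c * norm z" by (rule assms)
  finally show ?thesis using False by (metis mult_right_le_imp_le zero_less_norm_iff)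
qed (use assms in simp)

lemma cinner_ext: "(\<And>x. cinner x y = cinner x (z::'a::complex_hilbert)) \<Longrightarrow> y = z"
proof -
  assume *: "\<And>x. cinner x y = cinner x z"
  have "(norm (y - z))\<^sup>2 = 0"
    using *[of "y - z"] by (simp add: norm_sq_cinner cinner_diff_right)
  then show ?thesis by simp
qed

text \<open>The representing vector minimises the functional \<open>J x = \<parallel>x\<parallel>\<^sup>2 - 2 Re (f x)\<close>. Minimising sequences
  are Cauchy by the parallelogram identity, applied to the midpoint of two almost minimal vectors.\<close>

lemma Riesz:
  fixes f :: "'a::complex_hilbert \<Rightarrow> complex"
  assumes add: "\<And>x y. f (x + y) = f x + f y" and scale: "\<And>c x. f (c *\<^sub>C x) = c * f x"
    and bound: "\<And>x. cmod (f x) \<le> B * norm x"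
  obtains v where "\<And>x. f x = cinner v x"
proof -
  define J where "J = (\<lambda>x. (norm x)\<^sup>2 - 2 * Re (f x))"
  have fdiff: "f (x - y) = f x - f y" for x y
    using add[of "x - y" y] by simp
  have low: "J x \<ge> - B\<^sup>2" for x
  proof -
    have "Re (f x) \<le> B * norm x" using bound[of x] complex_Re_le_cmod[of "f x"] by linarith
    moreover have "0 \<le> (norm x - B)\<^sup>2" by simp
    ultimately show ?thesis unfolding J_def by (simp add: power2_eq_square algebra_simps)
  qed
  define m where "m = Inf (range J)"
  have bdd: "bdd_below (range J)" by (rule bdd_belowI2[OF low])
  have m_le: "m \<le> J x" for x unfolding m_def by (rule cInf_lower[OF _ bdd]) simp
  have "\<exists>x. J x < m + 1 / real (Suc k)" for k
    using cInf_lessD[of "range J" "m + 1 / real (Suc k)"] unfolding m_def by auto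
  then obtain X where X: "\<And>k. J (X k) < m + 1 / real (Suc k)" by metis
  have mid: "(norm (x - y))\<^sup>2 \<le> 2 * (J x - m) + 2 * (J y - m)" for x y
  proof -
    have "norm (x + y) = 2 * norm ((1/2) *\<^sub>R (x + y))" by simp
    then have 1: "(norm (x + y))\<^sup>2 = 4 * (norm ((1/2) *\<^sub>R (x + y)))\<^sup>2" by (simp add: power2_eq_square)
    have half: "f ((1/2) *\<^sub>R (x + y)) = (f x + f y) / 2"
      using scale[of "complex_of_real (1/2)" "x + y"] by (simp only: scaleC_of_real) (simp add: add)
    then have 2: "J ((1/2) *\<^sub>R (x + y)) = (norm (x + y))\<^sup>2 / 4 - Re (f x) - Re (f y)"
      unfolding J_def half using 1 by (simp add: field_simps)
    show ?thesis using m_le[of "(1/2) *\<^sub>R (x + y)"] 2 parallelogram[of x y] unfolding J_def by simp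
  qed
  have "Cauchy X"
  proof (rule metric_CauchyI)
    fix e :: real assume e: "e > 0"
    obtain n where n: "1 / real (Suc n) < e\<^sup>2 / 4"
      using e by (metis nat_approx_posE zero_less_divide_iff zero_less_numeral zero_less_power)
    { fix i j assume ij: "i \<ge> n" "j \<ge> n"
      have "J (X k) - m < e\<^sup>2 / 4" if "k \<ge> n" for k
      proof -
        have "1 / real (Suc k) \<le> 1 / real (Suc n)" using that by (simp add: frac_le)
        then show ?thesis using X[of k] n by linarith
      qed
      from this[OF ij(1)] this[OF ij(2)]
      have "2 * (J (X i) - m) + 2 * (J (X j) - m) < 2 * (e\<^sup>2 / 4) + 2 * (e\<^sup>2 / 4)"
        by (intro add_strict_mono mult_strict_left_mono) simp_all
      then have "(norm (X i - X j))\<^sup>2 < e\<^sup>2"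
        using mid[of "X i" "X j"] by simp
      then have "dist (X i) (X j) < e" using e by (simp add: dist_norm power2_less_imp_less) }
    then show "\<exists>M. \<forall>m\<ge>M. \<forall>n\<ge>M. dist (X m) (X n) < e" by blast
  qed
  then obtain v where v: "X \<longlonglongrightarrow> v" using Cauchy_convergent convergent_def by blast
  have "J v \<le> m"
  proof -
    have "(\<lambda>k. f (X k)) \<longlonglongrightarrow> f v"
    proof (rule Lim_null_comparison[THEN Lim_null[THEN iffD2]])
      show "\<forall>\<^sub>F k in sequentially. norm (f (X k) - f v) \<le> B * norm (X k - v)"
        by (rule always_eventually) (use bound in \<open>simp flip: fdiff\<close>)
      show "(\<lambda>k. B * norm (X k - v)) \<longlonglongrightarrow> 0"
        using v by (auto intro!: tendsto_mult_right_zero tendsto_norm_zero LIM_zero)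
    qed
    then have "(\<lambda>k. J (X k)) \<longlonglongrightarrow> J v" unfolding J_def using v by (intro tendsto_intros)
    moreover have "(\<lambda>k. m + 1 / real (Suc k)) \<longlonglongrightarrow> m + 0"
      by (intro tendsto_intros LIMSEQ_Suc[OF lim_const_over_n])
    ultimately show ?thesis using X by (intro LIMSEQ_le[of "\<lambda>k. J (X k)" _ "\<lambda>k. m + 1 / real (Suc k)"]) (auto intro: less_imp_le)
  qed
  then have min: "J v \<le> J x" for x using m_le[of x] by linarith
  \<comment> \<open>the first variation of \<open>J\<close> at its minimiser vanishes\<close>
  have Re_eq: "Re (f x) = Re (cinner v x)" for x
  proof (rule ccontr)
    define a where "a = Re (cinner v x) - Re (f x)"
    assume "Re (f x) \<noteq> Re (cinner v x)"
    then have a: "a \<noteq> 0" by (simp add: a_def)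
    define b where "b = (norm x)\<^sup>2 + 1"
    have b: "b > 0" "(norm x)\<^sup>2 < b" unfolding b_def by (rule add_nonneg_pos) simp_all
    \<comment> \<open>\<open>t\<close> nearly minimises the quadratic polynomial \<open>2 a t + \<parallel>x\<parallel>\<^sup>2 t\<^sup>2\<close>; the \<open>+ 1\<close> in \<open>b\<close> covers \<open>x = 0\<close>\<close>
    define t where "t = - a / b"
    have "J (v + complex_of_real t *\<^sub>C x) = J v + 2 * t * a + t\<^sup>2 * (norm x)\<^sup>2"
      unfolding J_def a_def
      by (simp add: norm_sq_add add scale cinner_scaleC_right norm_scaleC power_mult_distrib right_diff_distrib)
    then have "0 \<le> 2 * t * a + t\<^sup>2 * (norm x)\<^sup>2" using min[of "v + complex_of_real t *\<^sub>C x"] by simp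
    also have "\<dots> \<le> 2 * t * a + t\<^sup>2 * b" using b by (intro add_left_mono mult_left_mono) auto
    also have "\<dots> = 2 * t * a + t * (t * b)" by (simp add: power2_eq_square)
    also have "\<dots> = - (a * a / b)" using b by (simp add: t_def)
    also have "\<dots> < 0" using a b by (metis divide_pos_pos neg_less_0_iff_less not_real_square_gt_zero)
    finally show False by simp
  qed
  have "f x = cinner v x" for x
  proof (rule complex_eqI)
    show "Re (f x) = Re (cinner v x)" by (rule Re_eq)
    show "Im (f x) = Im (cinner v x)"
      using Re_eq[of "\<i> *\<^sub>C x"] by (simp add: scale cinner_scaleC_right)
  qed
  then show thesis by (rule that)
qed

lemma bounded_clinear_bounded: "bounded_clinear T \<Longrightarrow> norm (T x) \<le> onorm T * norm x"
  unfolding bounded_clinear_def by (auto intro: onorm)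

lemma bounded_clinear_add: "bounded_clinear T \<Longrightarrow> T (x + y) = T x + T y"
  unfolding bounded_clinear_def by (auto dest: bounded_linear.linear simp: linear_add)

lemma bounded_clinear_diff: "bounded_clinear T \<Longrightarrow> T (x - y) = T x - T y"
  unfolding bounded_clinear_def by (auto dest: bounded_linear.linear simp: linear_diff)

lemma bounded_clinear_zero: "bounded_clinear T \<Longrightarrow> T 0 = 0"
  unfolding bounded_clinear_def by (auto dest: bounded_linear.linear simp: linear_0)

lemma bounded_clinear_scaleC: "bounded_clinear T \<Longrightarrow> T (c *\<^sub>C x) = c *\<^sub>C T x"
  unfolding bounded_clinear_def by auto

lemma bounded_clinear_sum: "bounded_clinear T \<Longrightarrow> T (\<Sum>i\<in>I. f i) = (\<Sum>i\<in>I. T (f i))"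
  unfolding bounded_clinear_def by (auto dest: bounded_linear.linear simp: linear_sum)

lemma bounded_clinearI:
  fixes T :: "'a::complex_hilbert \<Rightarrow> 'a"
  assumes "\<And>x y. T (x + y) = T x + T y" "\<And>c x. T (c *\<^sub>C x) = c *\<^sub>C T x"
    "\<And>x. norm (T x) \<le> B * norm x"
  shows "bounded_clinear T"
proof -
  have "T (r *\<^sub>R x) = r *\<^sub>R T x" for r x
    using assms(2)[of "of_real r" x] by (simp add: scaleC_of_real)
  then have "bounded_linear T" 
    using assms by (intro bounded_linear_intro[where K=B]) (auto simp: mult.commute)
  then show ?thesis using assms by (auto simp: bounded_clinear_def)
qed

lemma bounded_clinear_scaleC_const: "bounded_clinear (\<lambda>x. c *\<^sub>C x)"
  by (rule bounded_clinearI[where B="cmod c"])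
     (auto simp: scaleC_add_right scaleC_scaleC mult.commute norm_scaleC)

lemma bounded_clinear_id: "bounded_clinear id"
  by (rule bounded_clinearI[where B=1]) auto

lemma bounded_clinear_comp: "bounded_clinear S \<Longrightarrow> bounded_clinear T \<Longrightarrow> bounded_clinear (S \<circ> T)"
  unfolding bounded_clinear_def comp_def by (auto intro: bounded_linear_compose)

lemma bounded_clinear_plus: "bounded_clinear S \<Longrightarrow> bounded_clinear T \<Longrightarrow> bounded_clinear (\<lambda>x. S x + T x)"
  unfolding bounded_clinear_def by (auto intro: bounded_linear_add simp: scaleC_add_right)

lemma bounded_clinear_funpow: "bounded_clinear T \<Longrightarrow> bounded_clinear (T ^^ n)"
  by (induction n) (auto intro: bounded_clinear_id bounded_clinear_comp)

text \<open>The Riesz theorem provides an adjoint, and \<open>cinner_ext\<close> its uniqueness, so the definite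
  description in \<open>cadjoint\<close> denotes it.\<close>

lemma cinner_cadjoint:
  assumes "bounded_clinear T"
  shows "cinner (T x) y = cinner x (cadjoint T y)"
proof -
  have "\<exists>w. \<forall>x. cinner (T x) y = cinner x w" for y
  proof -
    have *: "cmod (cinner y (T x)) \<le> (norm y * onorm T) * norm x" for x
      using Cauchy_Schwarz_cinner[of y "T x"] bounded_clinear_bounded[OF assms, of x]
      by (metis mult.assoc mult_left_mono norm_ge_zero order_trans)
    obtain v where v: "\<And>x. cinner y (T x) = cinner v x"
      by (rule Riesz[of "\<lambda>x. cinner y (T x)", OF _ _ *])
        (auto simp: bounded_clinear_add[OF assms] bounded_clinear_scaleC[OF assms] cinner_add_right cinner_scaleC_right)
    show ?thesis using v by (metis cinner_commute)
  qed
  then obtain S where S: "\<And>x y. cinner (T x) y = cinner x (S y)" by metis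
  have "cadjoint T = S"
    unfolding cadjoint_def
  proof (rule the_equality)
    show "\<forall>x y. cinner (T x) y = cinner x (S y)" using S by blast
    fix S' assume "\<forall>x y. cinner (T x) y = cinner x (S' y)"
    then show "S' = S" using S by (intro ext cinner_ext) metis
  qed
  then show ?thesis using S by simp
qed

lemma cinner_adjoint_flip:
  assumes "\<And>x y. cinner (T x) y = cinner x (Ts (y::'a::complex_hilbert))"
  shows "cinner (Ts x) y = cinner x (T y)"
  by (metis assms cinner_commute)

lemma adjoint_bound:
  fixes T Ts :: "'a::complex_hilbert \<Rightarrow> 'a"
  assumes "\<And>x y. cinner (T x) y = cinner x (Ts y)" and "\<And>x. norm (T x) \<le> B * norm x" 
  shows "norm (Ts x) \<le> B * norm x"
proof (cases "Ts x = 0")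
  case True
  have "0 \<le> B * norm x" using assms(2)[of x] norm_ge_zero order_trans by blast
  with True show ?thesis by simp
next
  case False
  have "(norm (Ts x))\<^sup>2 = Re (cinner (T (Ts x)) x)" by (simp add: norm_sq_cinner assms(1))
  also have "\<dots> \<le> norm (T (Ts x)) * norm x"
    using Cauchy_Schwarz_cinner complex_Re_le_cmod order_trans by blast
  also have "\<dots> \<le> (B * norm (Ts x)) * norm x" by (intro mult_right_mono assms) auto
  finally show ?thesis using False by (simp add: power2_eq_square mult_ac)
qed

lemma adjoint_linear:
  fixes T Ts :: "'a::complex_hilbert \<Rightarrow> 'a"
  assumes "\<And>x y. cinner (T x) y = cinner x (Ts y)"
  shows "Ts (x + y) = Ts x + Ts y" and "Ts (c *\<^sub>C x) = c *\<^sub>C Ts x"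
  by (rule cinner_ext; simp add: assms[symmetric] cinner_add_right cinner_scaleC_right)+

lemma bounded_clinear_adjoint:
  fixes T Ts :: "'a::complex_hilbert \<Rightarrow> 'a"
  assumes "\<And>x y. cinner (T x) y = cinner x (Ts y)" and "\<And>x. norm (T x) \<le> B * norm x"
  shows "bounded_clinear Ts"
  using adjoint_linear[of T Ts, OF assms(1)] adjoint_bound[of T Ts, OF assms] by (rule bounded_clinearI)

section \<open>The defect form of a contraction\<close>

lemma bounded_convex_sequence_decreases:
  fixes c :: "nat \<Rightarrow> real"
  assumes conv: "\<And>m. 2 * c (Suc m) \<le> c m + c (Suc (Suc m))" and bound: "\<And>m. c m \<le> b"
  shows "c 1 \<le> c 0"
proof (rule ccontr)
  assume "\<not> c 1 \<le> c 0"
  then have pos: "c 1 - c 0 > 0" by simp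
  have step: "c (Suc m) - c m \<ge> c 1 - c 0" for m
    by (induction m) (use conv in \<open>auto simp: algebra_simps intro: order_trans\<close>, smt (verit) conv)
  have grow: "c m \<ge> c 0 + real m * (c 1 - c 0)" for m
  proof (induction m)
    case (Suc m) then show ?case using step[of m] by (simp add: algebra_simps)
  qed simp
  obtain m where "real m * (c 1 - c 0) > b - c 0" using reals_Archimedean3[OF pos] by blast
  with grow[of m] bound[of m] show False by simp
qed

text \<open>The quadratic form \<open>e v = K\<^sup>2 \<parallel>v\<parallel>\<^sup>2 - \<parallel>G v\<parallel>\<^sup>2\<close> is nonnegative, and \<open>A\<close>, \<open>As\<close> are adjoint to each other
  for it as well. Hence the values of \<open>e\<close> along the orbit \<open>v, A v, As A v, A As A v, \<dots>\<close> form a convex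
  sequence. It is bounded because \<open>A\<close> is a contraction, so it cannot increase in its first step.
  This replaces the use of the square root of the positive operator \<open>K\<^sup>2 - G* G\<close>.\<close>

lemma energy_contraction:
  fixes A As G :: "'a::complex_hilbert \<Rightarrow> 'a"
  assumes adj: "\<And>x y. cinner (A x) y = cinner x (As y)"
    and contr: "\<And>x. norm (A x) \<le> norm x"
    and G: "bounded_clinear G" "\<And>x. norm (G x) \<le> K * norm x"
    and comm: "\<And>x. G (A x) = A (G x)" "\<And>x. G (As x) = As (G x)"
  shows "K\<^sup>2 * (norm (A v))\<^sup>2 - (norm (G (A v)))\<^sup>2 \<le> K\<^sup>2 * (norm v)\<^sup>2 - (norm (G v))\<^sup>2"
proof -
  define e where "e = (\<lambda>v. K\<^sup>2 * (norm v)\<^sup>2 - (norm (G v))\<^sup>2)"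
  have e_nonneg: "e v \<ge> 0" for v
    using power_mono[OF G(2)[of v], of 2] by (simp add: e_def power_mult_distrib)
  have midpoint: "2 * e (B w) \<le> e w + e (Bs (B w))"
    if adjB: "\<And>x y. cinner (B x) y = cinner x (Bs y)"
      and "\<And>x. G (B x) = B (G x)" "\<And>x. G (Bs x) = Bs (G x)" for B Bs w
  proof -
    \<comment> \<open>the mixed term of \<open>e (w - Bs (B w))\<close> equals \<open>e (B w)\<close> by adjointness\<close>
    have "0 \<le> e (w - Bs (B w))" by (rule e_nonneg)
    also have "\<dots> = e w + e (Bs (B w)) - 2 * e (B w)"
      unfolding e_def using that
      by (simp add: bounded_clinear_diff[OF G(1)] norm_sq_diff norm_sq_cinner[of "B w"] norm_sq_cinner[of "B (G w)"] algebra_simps)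
    finally show ?thesis by simp
  qed
  have contr': "norm (As x) \<le> norm x" for x
    using adjoint_bound[of A As 1] adj contr by simp
  define u where "u = rec_nat v (\<lambda>m x. if even m then A x else As x)"
  have u0: "u 0 = v" and uS: "u (Suc m) = (if even m then A (u m) else As (u m))" for m
    by (auto simp: u_def)
  have "norm (u m) \<le> norm v" for m
    by (induction m) (auto simp: u0 uS intro: order_trans[OF contr] order_trans[OF contr'])
  then have "e (u m) \<le> K\<^sup>2 * (norm v)\<^sup>2" for m
    unfolding e_def by (smt (verit) mult_left_mono norm_ge_zero power_mono zero_le_power2)
  moreover have "2 * e (u (Suc m)) \<le> e (u m) + e (u (Suc (Suc m)))" for m
    using midpoint[of A As "u m"] midpoint[of As A "u m"] adj comm cinner_adjoint_flip[of A As, OF adj]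
    by (auto simp: uS)
  ultimately have "e (u 1) \<le> e (u 0)" by (rule bounded_convex_sequence_decreases[rotated])
  then show ?thesis by (simp add: u0 uS e_def)
qed

text \<open>The defect form \<open>[u, v] = \<langle>u, v\<rangle> - \<langle>A u, A v\<rangle>\<close> is positive semidefinite, and \<open>G/K\<close> is a contraction for
  it by \<open>energy_contraction\<close>. The bound is the Cauchy--Schwarz inequality for this form in its
  arithmetic-geometric version, which is the one that can be summed later without further work.\<close>

lemma defect_form_bound:
  fixes A As G :: "'a::complex_hilbert \<Rightarrow> 'a"
  assumes adj: "\<And>x y. cinner (A x) y = cinner x (As y)"
    and contr: "\<And>x. norm (A x) \<le> norm x"
    and G: "bounded_clinear G" "\<And>x. norm (G x) \<le> K * norm x" and K: "K > 0"
    and comm: "\<And>x. G (A x) = A (G x)" "\<And>x. G (As x) = As (G x)"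
    and A: "bounded_clinear A"
  shows "2 * cmod (cinner u (G v) - cinner (A u) (G (A v)))
    \<le> K * (((norm u)\<^sup>2 - (norm (A u))\<^sup>2) + ((norm v)\<^sup>2 - (norm (A v))\<^sup>2))"
proof -
  define w where "w = complex_of_real (1/K) *\<^sub>C G v"
  define z where "z = cinner u w - cinner (A u) (A w)"
  obtain c where c: "cmod c = 1" "complex_of_real (cmod z) = c * z" by (rule unimodular_phase)
  have Aw: "A w = complex_of_real (1/K) *\<^sub>C G (A v)"
    by (simp add: w_def bounded_clinear_scaleC[OF A] comm)
  have z: "z = (cinner u (G v) - cinner (A u) (G (A v))) / K"
    by (simp add: z_def Aw) (simp add: w_def cinner_scaleC_right diff_divide_distrib)
  have "(norm (A (u - c *\<^sub>C w)))\<^sup>2 \<le> (norm (u - c *\<^sub>C w))\<^sup>2"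
    by (intro power_mono contr) auto
  then have 1: "2 * Re (c * z) \<le> ((norm u)\<^sup>2 - (norm (A u))\<^sup>2) + ((norm w)\<^sup>2 - (norm (A w))\<^sup>2)"
    by (simp add: z_def norm_sq_diff bounded_clinear_diff[OF A] bounded_clinear_scaleC[OF A]
        norm_scaleC c(1) cinner_scaleC_right algebra_simps)
  have "(norm w)\<^sup>2 - (norm (A w))\<^sup>2 = ((norm (G v))\<^sup>2 - (norm (G (A v)))\<^sup>2) / K\<^sup>2"
    unfolding Aw unfolding w_def using K
    by (simp add: norm_scaleC power_mult_distrib norm_divide power_divide diff_divide_distrib)
  also have "\<dots> \<le> (norm v)\<^sup>2 - (norm (A v))\<^sup>2"
    using energy_contraction[of A As G K v, OF adj contr G comm] K
    by (subst pos_divide_le_eq) (simp_all add: algebra_simps)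
  finally have 2: "(norm w)\<^sup>2 - (norm (A w))\<^sup>2 \<le> (norm v)\<^sup>2 - (norm (A v))\<^sup>2" .
  have "Re (c * z) = cmod z" using c(2) by (metis Re_complex_of_real)
  with 1 2 have "2 * cmod z \<le> ((norm u)\<^sup>2 - (norm (A u))\<^sup>2) + ((norm v)\<^sup>2 - (norm (A v))\<^sup>2)"
    by linarith
  then have "K * (2 * cmod z) \<le> K * (((norm u)\<^sup>2 - (norm (A u))\<^sup>2) + ((norm v)\<^sup>2 - (norm (A v))\<^sup>2))"
    using K by (intro mult_left_mono) auto
  moreover have "cmod z = cmod (cinner u (G v) - cinner (A u) (G (A v))) / K"
    using K by (simp add: z norm_divide)
  ultimately show ?thesis using K by simp
qed

section \<open>Roots of unity and Fejer means\<close>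

definition unity :: "nat \<Rightarrow> nat \<Rightarrow> complex" where
  "unity L l = cis (2 * pi * real l / real L)"

lemma norm_unity [simp]: "cmod (unity L l) = 1"
  by (simp add: unity_def)

lemma unity_nonzero [simp]: "unity L l \<noteq> 0"
  by (simp add: unity_def)

lemma sum_unity_power_int:
  assumes "\<bar>k\<bar> < int L"
  shows "(\<Sum>l<L. unity L l powi k) = (if k = 0 then of_nat L else 0)"
proof (cases "k = 0")
  case False
  define z where "z = cis (2 * pi * real_of_int k / real L)"
  have L: "L > 0" using assms by auto
  have pow: "unity L l powi k = z ^ l" for l
    by (simp add: unity_def z_def cis_power_int Complex.DeMoivre field_simps)
  have "z \<noteq> 1"
  proof
    assume "z = 1"
    then have "cos (2 * pi * real_of_int k / real L) = 1" unfolding z_def by (metis cis.simps(1) one_complex.simps(1))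
    then obtain m :: int where "2 * pi * real_of_int k / real L = of_int m * 2 * pi"
      by (auto simp: cos_one_2pi_int)
    then have "real_of_int k = real_of_int (m * int L)" using L by (simp add: field_simps)
    then have "k = m * int L" by linarith
    with False assms show False
      by (metis abs_mult abs_of_nat dvd_triv_right dvd_imp_le_int linorder_not_less)
  qed
  moreover have "z ^ L = 1"
    using L by (simp add: z_def Complex.DeMoivre field_simps)
      (metis cis_multiple_2pi Ints_of_int mult.assoc mult.commute)
  ultimately have "(\<Sum>l<L. z ^ l) = 0" by (simp add: sum_gp_strict)
  with False show ?thesis by (simp add: pow)
qed simp

text \<open>The condition on \<open>L\<close> guarantees that no two of the exponents involved agree modulo \<open>L\<close>, so that the
  discrete average over the roots of unity is the exact Fourier coefficient.\<close>

lemma unity_extracts_coefficient: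
  assumes "\<bar>j\<bar> \<le> int J" "d + J < L"
  shows "(\<Sum>l<L. unity L l powi j * (\<Sum>k\<in>{- int d..int d}. unity L l powi k * a k))
    = of_nat L * (if \<bar>j\<bar> \<le> int d then a (- j) else 0)"
proof -
  have "(\<Sum>l<L. unity L l powi j * (\<Sum>k\<in>{- int d..int d}. unity L l powi k * a k))
      = (\<Sum>k\<in>{- int d..int d}. \<Sum>l<L. unity L l powi (j + k) * a k)"
    by (simp add: sum_distrib_left power_int_add mult.assoc) (rule sum.swap)
  also have "\<dots> = (\<Sum>k\<in>{- int d..int d}. (if k = - j then of_nat L * a k else 0))"
  proof (intro sum.cong refl)
    fix k assume "k \<in> {- int d..int d}"
    then have "\<bar>j + k\<bar> < int L" using assms by auto
    then show "(\<Sum>l<L. unity L l powi (j + k) * a k) = (if k = - j then of_nat L * a k else 0)"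
      by (simp add: sum_distrib_right[symmetric] sum_unity_power_int add_eq_0_iff add_eq_0_iff2)
  qed
  also have "\<dots> = of_nat L * (if \<bar>j\<bar> \<le> int d then a (- j) else 0)"
    by (auto simp: sum.delta)
  finally show ?thesis .
qed

lemma Laurent_coefficient_bound:
  fixes B :: "int \<Rightarrow> 'a::complex_hilbert"
  assumes supp: "\<bar>k\<bar> \<le> int d"
    and bound: "\<And>\<omega>. cmod \<omega> = 1 \<Longrightarrow> norm (\<Sum>k\<in>{- int d..int d}. (\<omega> powi k) *\<^sub>C B k) \<le> K"
  shows "norm (B k) \<le> K"
proof (rule norm_le_of_cinner)
  show "0 \<le> K" using bound[of 1] norm_ge_zero order_trans by (metis norm_one)
  fix y :: 'a
  define L where "L = 2 * d + 1"
  define G where "G = (\<lambda>l. \<Sum>k\<in>{- int d..int d}. (unity L l powi k) *\<^sub>C B k)"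
  have "of_nat L * cinner y (B k) = (\<Sum>l<L. unity L l powi (- k) * cinner y (G l))"
    using unity_extracts_coefficient[of "- k" d d L "\<lambda>k. cinner y (B k)"] supp
    by (simp add: L_def G_def cinner_sum_right cinner_scaleC_right)
  then have "real L * cmod (cinner y (B k)) = cmod (\<Sum>l<L. unity L l powi (- k) * cinner y (G l))"
    by (metis norm_mult norm_of_nat)
  also have "\<dots> \<le> (\<Sum>l<L. K * norm y)"
  proof (rule sum_norm_le)
    fix l
    have "cmod (cinner y (G l)) \<le> norm y * norm (G l)" by (rule Cauchy_Schwarz_cinner)
    also have "\<dots> \<le> norm y * K" unfolding G_def by (intro mult_left_mono bound) auto
    finally show "cmod (unity L l powi (- k) * cinner y (G l)) \<le> K * norm y"
      by (simp add: norm_mult norm_power_int mult.commute)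
  qed
  finally show "cmod (cinner y (B k)) \<le> K * norm y" by (simp add: L_def)
qed

text \<open>The truncated geometric series of \<open>A / \<omega>\<close>, whose full sum for \<open>|\<omega>| = 1\<close> is the resolvent
  \<open>(1 - A / \<omega>)\<inverse>\<close> that occurs in the Poisson kernel.\<close>

definition geom :: "('a::complex_hilbert \<Rightarrow> 'a) \<Rightarrow> complex \<Rightarrow> nat \<Rightarrow> 'a \<Rightarrow> 'a" where
  "geom A \<omega> M x = (\<Sum>i<M. (\<omega> powi (- int i)) *\<^sub>C (A ^^ i) x)"

text \<open>With \<open>s\<close> the sum \<open>geom A \<omega> (M + 1)\<close>, the operator \<open>s + s* - 1\<close> is a partial sum of the Poisson kernel
  of \<open>A\<close> at \<open>\<omega>\<close>. The form is \<open>N\<close> times the Fejer mean of these partial sums, composed with a coefficient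
  operator \<open>G\<close>; it is written as a sesquilinear form so that adjoints stay implicit.\<close>

definition Fejer_form :: "('a::complex_hilbert \<Rightarrow> 'a) \<Rightarrow> ('a \<Rightarrow> 'a) \<Rightarrow> complex \<Rightarrow> nat \<Rightarrow> 'a \<Rightarrow> 'a \<Rightarrow> complex" where
  "Fejer_form A G \<omega> N y x = (\<Sum>M<N. cinner y (G (geom A \<omega> (Suc M) x))
      + cinner (geom A \<omega> (Suc M) y) (G x) - cinner y (G x))"

lemma geom_Suc:
  assumes A: "bounded_clinear A" and "\<omega> \<noteq> 0"
  shows "geom A \<omega> (Suc M) x = x + inverse \<omega> *\<^sub>C A (geom A \<omega> M x)"
proof -
  have "(\<Sum>i<M. (\<omega> powi (- int (Suc i))) *\<^sub>C (A ^^ Suc i) x) = inverse \<omega> *\<^sub>C A (geom A \<omega> M x)"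
    using assms(2) unfolding geom_def bounded_clinear_sum[OF A] scaleC_sum_right
    by (intro sum.cong) (simp_all add: bounded_clinear_scaleC[OF A] scaleC_scaleC power_int_minus
        del: of_nat_Suc)
  then show ?thesis
    by (simp add: geom_def sum.lessThan_Suc_shift del: funpow.simps sum.lessThan_Suc of_nat_Suc)
qed

text \<open>The partial sums themselves are not positive, but their sum over \<open>M < N\<close> telescopes: from
  \<open>s\<^sub>M\<^sub>+\<^sub>1 = 1 + A s\<^sub>M / \<omega>\<close> one gets that \<open>s\<^sub>M* (1 - A* A) s\<^sub>M\<close> equals
  \<open>s\<^sub>M* s\<^sub>M - s\<^sub>M\<^sub>+\<^sub>1* s\<^sub>M\<^sub>+\<^sub>1 + s\<^sub>M\<^sub>+\<^sub>1 + s\<^sub>M\<^sub>+\<^sub>1* - 1\<close>. What results is manifestly positive for \<open>G = id\<close>.\<close>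

lemma Fejer_form_eq:
  assumes A: "bounded_clinear A" and G: "bounded_clinear G" and \<omega>: "cmod \<omega> = 1"
  shows "Fejer_form A G \<omega> N y x = cinner (geom A \<omega> N y) (G (geom A \<omega> N x))
    + (\<Sum>M<N. cinner (geom A \<omega> M y) (G (geom A \<omega> M x)) - cinner (A (geom A \<omega> M y)) (G (A (geom A \<omega> M x))))"
proof (induction N)
  case 0
  then show ?case by (simp add: Fejer_form_def geom_def bounded_clinear_zero[OF G])
next
  case (Suc N)
  define s where "s = (\<lambda>x. geom A \<omega> N x)"
  define s' where "s' = (\<lambda>x. geom A \<omega> (Suc N) x)"
  have \<omega>0: "\<omega> \<noteq> 0" using \<omega> by auto
  have *: "inverse \<omega> *\<^sub>C A (s x) = s' x - x" for x
    unfolding s_def s'_def by (simp add: geom_Suc[OF A \<omega>0])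
  have "cnj (inverse \<omega>) * inverse \<omega> = 1"
    using \<omega> complex_norm_square[of "inverse \<omega>"] by (simp add: norm_inverse mult.commute)
  then have "cinner (A (s y)) (G (A (s x))) = cinner (inverse \<omega> *\<^sub>C A (s y)) (G (inverse \<omega> *\<^sub>C A (s x)))"
    by (simp only: bounded_clinear_scaleC[OF G] cinner_scaleC_left cinner_scaleC_right mult.assoc[symmetric])
      (simp add: mult.commute)
  also have "\<dots> = cinner (s' y) (G (s' x)) - (cinner y (G (s' x)) + cinner (s' y) (G x) - cinner y (G x))"
    unfolding * by (simp add: bounded_clinear_diff[OF G] cinner_diff_left cinner_diff_right)
  finally show ?case
    using Suc unfolding s_def s'_def Fejer_form_def by simp
qed

text \<open>Every summand in \<open>Fejer_form_eq\<close> is estimated by \<open>defect_form_bound\<close> or the Cauchy--Schwarz inequality;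
  the right-hand sides add up to the diagonal values of the form for \<open>G = id\<close>.\<close>

lemma Fejer_form_bound:
  fixes A As G :: "'a::complex_hilbert \<Rightarrow> 'a"
  assumes A: "bounded_clinear A" and adj: "\<And>x y. cinner (A x) y = cinner x (As y)"
    and contr: "\<And>x. norm (A x) \<le> norm x"
    and G: "bounded_clinear G" "\<And>x. norm (G x) \<le> K * norm x" and K: "K > 0"
    and comm: "\<And>x. G (A x) = A (G x)" "\<And>x. G (As x) = As (G x)"
    and \<omega>: "cmod \<omega> = 1"
  shows "2 * cmod (Fejer_form A G \<omega> N y x)
    \<le> K * (Re (Fejer_form A id \<omega> N y y) + Re (Fejer_form A id \<omega> N x x))"
proof -
  let ?s = "geom A \<omega>"
  have CS: "2 * cmod (cinner u (G v)) \<le> K * ((norm u)\<^sup>2 + (norm v)\<^sup>2)" for u v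
  proof -
    have "2 * cmod (cinner u (G v)) \<le> 2 * (norm u * (K * norm v))"
      by (intro mult_left_mono order_trans[OF Cauchy_Schwarz_cinner] G) auto
    also have "\<dots> = K * (2 * norm u * norm v)" by simp
    also have "\<dots> \<le> K * ((norm u)\<^sup>2 + (norm v)\<^sup>2)"
      using K sum_squares_bound[of "norm u" "norm v"] by (intro mult_left_mono) auto
    finally show ?thesis .
  qed
  have diag: "Re (Fejer_form A id \<omega> N x x)
      = (norm (?s N x))\<^sup>2 + (\<Sum>M<N. (norm (?s M x))\<^sup>2 - (norm (A (?s M x)))\<^sup>2)" for x
    by (simp add: Fejer_form_eq[OF A bounded_clinear_id \<omega>] norm_sq_cinner)
  have "2 * cmod (Fejer_form A G \<omega> N y x) \<le> 2 * cmod (cinner (?s N y) (G (?s N x)))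
      + (\<Sum>M<N. 2 * cmod (cinner (?s M y) (G (?s M x)) - cinner (A (?s M y)) (G (A (?s M x)))))"
    unfolding Fejer_form_eq[OF A G(1) \<omega>]
    unfolding sum_distrib_left[symmetric] distrib_left[symmetric]
    by (intro mult_left_mono norm_triangle_le add_left_mono norm_sum) simp_all
  also have "\<dots> \<le> K * ((norm (?s N y))\<^sup>2 + (norm (?s N x))\<^sup>2)
      + (\<Sum>M<N. K * (((norm (?s M y))\<^sup>2 - (norm (A (?s M y)))\<^sup>2) + ((norm (?s M x))\<^sup>2 - (norm (A (?s M x)))\<^sup>2)))"
    by (intro add_mono sum_mono CS defect_form_bound[of A As G K, OF adj contr G K comm A])
  also have "\<dots> = K * (Re (Fejer_form A id \<omega> N y y) + Re (Fejer_form A id \<omega> N x x))"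
    unfolding diag by (simp only: sum_distrib_left[symmetric] sum.distrib distrib_left)
  finally show ?thesis .
qed

definition Laurent_op :: "nat \<Rightarrow> (int \<Rightarrow> 'a::complex_hilbert \<Rightarrow> 'a) \<Rightarrow> complex \<Rightarrow> 'a \<Rightarrow> 'a" where
  "Laurent_op d B \<omega> x = (\<Sum>k\<in>{- int d..int d}. (\<omega> powi k) *\<^sub>C B k x)"

lemma funpow_cinner_adjoint:
  fixes A As :: "'a::complex_hilbert \<Rightarrow> 'a"
  assumes adj: "\<And>x y. cinner (A x) y = cinner x (As y)"
  shows "cinner ((A ^^ i) x) y = cinner x ((As ^^ i) y)"
  by (induction i arbitrary: x y) (simp_all add: adj funpow_swap1)

text \<open>Averaging \<open>\<omega>\<close> over roots of unity picks out, from the product of the Laurent polynomial with the kernel,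
  the terms in which the powers of \<open>\<omega>\<close> cancel: \<open>B i\<close> meets \<open>A\<^sup>i\<close> and \<open>B (-i)\<close> meets \<open>(A*)\<^sup>i\<close>.\<close>

lemma Fejer_form_average:
  fixes A As :: "'a::complex_hilbert \<Rightarrow> 'a"
  assumes adj: "\<And>x y. cinner (A x) y = cinner x (As y)"
    and B: "\<And>k. bounded_clinear (B k)"
    and supp: "\<And>k x. \<bar>k\<bar> > int d \<Longrightarrow> B k x = 0" and L: "N + d < L"
  shows "(\<Sum>l<L. Fejer_form A (Laurent_op d B (unity L l)) (unity L l) N y x)
    = of_nat L * (\<Sum>M<N. cinner y ((\<Sum>i\<le>M. B (int i) ((A ^^ i) x)) + (\<Sum>i\<le>M. (As ^^ i) (B (- int i) x)) - B 0 x))"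
proof -
  let ?w = "unity L" and ?G = "\<lambda>l. Laurent_op d B (unity L l)"
  have G: "cinner u (?G l v) = (\<Sum>k\<in>{- int d..int d}. ?w l powi k * cinner u (B k v))" for u v l
    by (simp add: Laurent_op_def cinner_sum_right cinner_scaleC_right)
  have Bsupp: "(if \<bar>k\<bar> \<le> int d then cinner u (B k v) else 0) = cinner u (B k v)" for k u v
    using supp[of k v] by auto
  have first: "(\<Sum>l<L. cinner y (?G l (geom A (?w l) (Suc M) x)))
      = of_nat L * (\<Sum>i\<le>M. cinner y (B (int i) ((A ^^ i) x)))" if "M < N" for M
  proof -
    have "cinner y (?G l (geom A (?w l) (Suc M) x))
        = (\<Sum>i\<le>M. ?w l powi (- int i) * (\<Sum>k\<in>{- int d..int d}. ?w l powi k * cinner y (B k ((A ^^ i) x))))" for l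
      unfolding G geom_def bounded_clinear_sum[OF B] bounded_clinear_scaleC[OF B] cinner_sum_right
        cinner_scaleC_right sum_distrib_left lessThan_Suc_atMost
      by (subst sum.swap) (simp add: mult_ac)
    then have "(\<Sum>l<L. cinner y (?G l (geom A (?w l) (Suc M) x)))
        = (\<Sum>i\<le>M. \<Sum>l<L. ?w l powi (- int i) * (\<Sum>k\<in>{- int d..int d}. ?w l powi k * cinner y (B k ((A ^^ i) x))))"
      by (simp add: sum.swap[of _ "{..<L}"])
    also have "\<dots> = (\<Sum>i\<le>M. of_nat L * cinner y (B (int i) ((A ^^ i) x)))"
    proof (rule sum.cong)
      fix i assume "i \<in> {..M}"
      then show "(\<Sum>l<L. ?w l powi (- int i) * (\<Sum>k\<in>{- int d..int d}. ?w l powi k * cinner y (B k ((A ^^ i) x))))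
          = of_nat L * cinner y (B (int i) ((A ^^ i) x))"
        using unity_extracts_coefficient[of "- int i" N d L "\<lambda>k. cinner y (B k ((A ^^ i) x))"] L that
          supp[of "int i" "(A ^^ i) x"] by (cases "i \<le> d") auto
    qed simp
    finally show ?thesis by (simp add: sum_distrib_left)
  qed
  have second: "(\<Sum>l<L. cinner (geom A (?w l) (Suc M) y) (?G l x))
      = of_nat L * (\<Sum>i\<le>M. cinner y ((As ^^ i) (B (- int i) x)))" if "M < N" for M
  proof -
    have conj: "cnj (?w l powi (- int i)) = ?w l powi int i" for l i
      by (simp add: unity_def cis_power_int cis_cnj Complex.DeMoivre)
    have "cinner (geom A (?w l) (Suc M) y) (?G l x)
        = (\<Sum>i\<le>M. ?w l powi int i * (\<Sum>k\<in>{- int d..int d}. ?w l powi k * cinner ((A ^^ i) y) (B k x)))" for l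
      unfolding geom_def cinner_sum_left cinner_scaleC_left G conj lessThan_Suc_atMost sum_distrib_left
      by (subst sum.swap) (simp add: mult_ac)
    then have "(\<Sum>l<L. cinner (geom A (?w l) (Suc M) y) (?G l x))
        = (\<Sum>i\<le>M. \<Sum>l<L. ?w l powi int i * (\<Sum>k\<in>{- int d..int d}. ?w l powi k * cinner ((A ^^ i) y) (B k x)))"
      by (simp add: sum.swap[of _ "{..<L}"])
    also have "\<dots> = (\<Sum>i\<le>M. of_nat L * cinner y ((As ^^ i) (B (- int i) x)))"
    proof (rule sum.cong)
      fix i assume "i \<in> {..M}"
      then show "(\<Sum>l<L. ?w l powi int i * (\<Sum>k\<in>{- int d..int d}. ?w l powi k * cinner ((A ^^ i) y) (B k x)))
          = of_nat L * cinner y ((As ^^ i) (B (- int i) x))"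
        using unity_extracts_coefficient[of "int i" N d L "\<lambda>k. cinner ((A ^^ i) y) (B k x)"] L that
          Bsupp[of "- int i" "(A ^^ i) y" x] by (simp add: funpow_cinner_adjoint[OF adj])
    qed simp
    finally show ?thesis by (simp add: sum_distrib_left)
  qed
  have third: "(\<Sum>l<L. cinner y (?G l x)) = of_nat L * cinner y (B 0 x)"
    using unity_extracts_coefficient[of 0 0 d L "\<lambda>k. cinner y (B k x)"] L by (simp add: G)
  show ?thesis
    unfolding Fejer_form_def
    by (subst sum.swap, simp only: sum.distrib sum_subtractf sum_distrib_left cinner_add_right
        cinner_diff_right cinner_sum_right)
      (simp add: first second third sum_distrib_left right_diff_distrib distrib_left)
qed

text \<open>Von Neumann's inequality for operator-valued trigonometric polynomials \<open>\<Sum>k. \<omega>\<^sup>k B k\<close>: positive powers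
  of \<open>\<omega>\<close> are replaced by powers of \<open>A\<close>, negative ones by powers of the adjoint. The coefficient of
  order \<open>0\<close> occurs in both sums and is therefore subtracted once. The bound holds for the \<open>N\<close>-th Fejer means by
  \<open>Fejer_form_bound\<close> and \<open>Fejer_form_average\<close>, and these means converge as \<open>N\<close> tends to infinity since
  all but the first \<open>d\<close> partial sums \<open>Z M\<close> coincide with \<open>Z d\<close>.\<close>

lemma harmonic_von_Neumann:
  fixes A As :: "'a::complex_hilbert \<Rightarrow> 'a"
  assumes A: "bounded_clinear A" and adj: "\<And>x y. cinner (A x) y = cinner x (As y)"
    and contr: "\<And>x. norm (A x) \<le> norm x"
    and B: "\<And>k. bounded_clinear (B k)"
    and comm: "\<And>k x. B k (A x) = A (B k x)" "\<And>k x. B k (As x) = As (B k x)"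
    and supp: "\<And>k x. \<bar>k\<bar> > int d \<Longrightarrow> B k x = 0"
    and K: "K > 0" "\<And>\<omega> x. cmod \<omega> = 1 \<Longrightarrow> norm (Laurent_op d B \<omega> x) \<le> K * norm x"
  shows "norm ((\<Sum>i\<le>d. B (int i) ((A ^^ i) x)) + (\<Sum>i\<le>d. (As ^^ i) (B (- int i) x)) - B 0 x) \<le> K * norm x"
proof -
  define Z where "Z = (\<lambda>M x. (\<Sum>i\<le>M. B (int i) ((A ^^ i) x)) + (\<Sum>i\<le>M. (As ^^ i) (B (- int i) x)) - B 0 x)"
  note As_lin = adjoint_linear[of A As, OF adj]
  have As: "bounded_clinear As" by (rule bounded_clinear_adjoint[of A As 1]) (use adj contr in auto)
  have As0: "(As ^^ i) 0 = 0" for i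
    using bounded_clinear_zero[OF bounded_clinear_funpow[OF As]] .
  have Zd: "Z M x = Z d x" if "M \<ge> d" for M x
  proof -
    have "(\<Sum>i\<le>M. B (int i) ((A ^^ i) x)) = (\<Sum>i\<le>d. B (int i) ((A ^^ i) x))"
      by (rule sum.mono_neutral_right) (use that supp in auto)
    moreover have "(\<Sum>i\<le>M. (As ^^ i) (B (- int i) x)) = (\<Sum>i\<le>d. (As ^^ i) (B (- int i) x))"
      by (rule sum.mono_neutral_right) (use that supp in \<open>auto simp: As0\<close>)
    ultimately show ?thesis by (simp add: Z_def)
  qed
  have G: "bounded_clinear (Laurent_op d B \<omega>)" if "cmod \<omega> = 1" for \<omega>
    by (rule bounded_clinearI[where B=K])
      (use K(2)[OF that] in \<open>auto simp: Laurent_op_def bounded_clinear_add[OF B] bounded_clinear_scaleC[OF B]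
         scaleC_add_right sum.distrib scaleC_sum_right scaleC_scaleC mult.commute\<close>)
  have Gcomm: "Laurent_op d B \<omega> (A x) = A (Laurent_op d B \<omega> x)"
    "Laurent_op d B \<omega> (As x) = As (Laurent_op d B \<omega> x)" for \<omega> x
    by (simp_all add: Laurent_op_def comm bounded_clinear_sum[OF A] bounded_clinear_scaleC[OF A]
        bounded_clinear_sum[OF As] bounded_clinear_scaleC[OF As])
  \<comment> \<open>the constant polynomial \<open>1\<close>, whose averages give the total mass of the kernel\<close>
  define I where "I = (\<lambda>k::int. if k = 0 then id else (\<lambda>x::'a. 0))"
  have I_id: "Laurent_op d I \<omega> = id" for \<omega>
  proof
    fix x
    have "Laurent_op d I \<omega> x = (\<Sum>k\<in>{- int d..int d}. if k = 0 then x else 0)"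
      unfolding Laurent_op_def I_def by (rule sum.cong) auto
    then show "Laurent_op d I \<omega> x = id x" by simp
  qed
  have ZI: "(\<Sum>i\<le>M. I (int i) ((A ^^ i) x)) + (\<Sum>i\<le>M. (As ^^ i) (I (- int i) x)) - I 0 x = x" for M x
  proof -
    have "(\<Sum>i\<le>M. I (int i) ((A ^^ i) x)) = (\<Sum>i\<le>M. if i = 0 then x else 0)"
      by (rule sum.cong) (auto simp: I_def)
    moreover have "(\<Sum>i\<le>M. (As ^^ i) (I (- int i) x)) = (\<Sum>i\<le>M. if i = 0 then x else 0)"
      by (rule sum.cong) (auto simp: I_def As0)
    ultimately show ?thesis by (simp add: I_def)
  qed
  have mean: "2 * cmod (\<Sum>M<N. cinner y (Z M x)) \<le> K * (real N * ((norm y)\<^sup>2 + (norm x)\<^sup>2))" for N y x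
  proof -
    define L where "L = N + d + 1"
    let ?F = "\<lambda>G l. Fejer_form A G (unity L l) N"
    have avgI: "(\<Sum>l<L. ?F id l y y) = complex_of_real (real L * (real N * (norm y)\<^sup>2))" for y
    proof -
      have IB: "bounded_clinear (I k)" for k
        using bounded_clinear_id[where 'a='a] bounded_clinear_scaleC_const[where 'a='a and c=0] by (simp add: I_def)
      have "I k x = 0" if "\<bar>k\<bar> > int d" for k x using that by (auto simp: I_def)
      from Fejer_form_average[of A As I d N L y y, OF adj IB this]
      have "(\<Sum>l<L. ?F id l y y) = of_nat L * (\<Sum>M<N. cinner y y)"
        unfolding I_id ZI by (simp only: L_def less_add_one)
      then show ?thesis by (simp flip: norm_cinner)
    qed
    have avg: "(\<Sum>l<L. ?F (Laurent_op d B (unity L l)) l y x) = of_nat L * (\<Sum>M<N. cinner y (Z M x))"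
      unfolding Z_def by (rule Fejer_form_average[OF adj B supp]) (simp_all add: L_def)
    have "real L * (2 * cmod (\<Sum>M<N. cinner y (Z M x)))
        = 2 * cmod (\<Sum>l<L. ?F (Laurent_op d B (unity L l)) l y x)"
      unfolding avg norm_mult norm_of_nat by (rule mult.left_commute)
    also have "\<dots> \<le> (\<Sum>l<L. 2 * cmod (?F (Laurent_op d B (unity L l)) l y x))"
      using mult_left_mono[OF norm_sum, of 2] by (subst sum_distrib_left[symmetric]) simp
    also have "\<dots> \<le> (\<Sum>l<L. K * (Re (?F id l y y) + Re (?F id l x x)))"
    proof (rule sum_mono)
      fix l
      show "2 * cmod (?F (Laurent_op d B (unity L l)) l y x) \<le> K * (Re (?F id l y y) + Re (?F id l x x))"
        by (rule Fejer_form_bound[of A As "Laurent_op d B (unity L l)" K "unity L l" N y x])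
          (fact A adj contr G[OF norm_unity] K(2)[OF norm_unity] K(1) Gcomm norm_unity)+
    qed
    also have "\<dots> = K * (Re (\<Sum>l<L. ?F id l y y) + Re (\<Sum>l<L. ?F id l x x))"
      by (simp only: Re_sum sum.distrib sum_distrib_left[symmetric])
    also have "\<dots> = real L * (K * (real N * ((norm y)\<^sup>2 + (norm x)\<^sup>2)))"
      unfolding avgI Re_complex_of_real by (simp add: algebra_simps)
    finally show ?thesis by (rule mult_left_le_imp_le) (simp add: L_def)
  qed
  have form: "2 * cmod (cinner y (Z d x)) \<le> K * ((norm y)\<^sup>2 + (norm x)\<^sup>2)" for y x
  proof (rule ccontr)
    define a where "a = cmod (cinner y (Z d x))"
    define b where "b = (norm y)\<^sup>2 + (norm x)\<^sup>2"
    assume "\<not> ?thesis"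
    then have gap: "2 * a - K * b > 0" by (simp add: a_def b_def)
    define E where "E = 2 * cmod (\<Sum>M<d. cinner y (Z M x))"
    obtain n where n: "real n * (2 * a - K * b) > E + K * (real d * b)"
      using reals_Archimedean3[OF gap] by blast
    have "(\<Sum>M<d + n. cinner y (Z M x)) = (\<Sum>M<d. cinner y (Z M x)) + (\<Sum>M\<in>{d..<d+n}. cinner y (Z M x))"
      unfolding lessThan_atLeast0 by (rule sum.atLeastLessThan_concat[symmetric]) simp_all
    also have "(\<Sum>M\<in>{d..<d+n}. cinner y (Z M x)) = (\<Sum>M\<in>{d..<d+n}. cinner y (Z d x))"
      by (rule sum.cong) (metis Zd atLeastLessThan_iff)+
    also have "\<dots> = of_nat n * cinner y (Z d x)" by simp
    finally have "of_nat n * cinner y (Z d x) = (\<Sum>M<d + n. cinner y (Z M x)) - (\<Sum>M<d. cinner y (Z M x))"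
      by simp
    then have "real n * a \<le> cmod (\<Sum>M<d + n. cinner y (Z M x)) + cmod (\<Sum>M<d. cinner y (Z M x))"
      unfolding a_def by (metis norm_mult norm_of_nat norm_triangle_ineq4)
    moreover have "2 * cmod (\<Sum>M<d + n. cinner y (Z M x)) \<le> K * (real d * b) + real n * (K * b)"
      using mean[where N="d + n" and y=y and x=x, folded b_def] by (simp add: algebra_simps)
    moreover have "real n * (2 * a - K * b) = 2 * (real n * a) - real n * (K * b)"
      by (simp add: algebra_simps)
    ultimately show False using n unfolding E_def by linarith
  qed
  show ?thesis
  proof (cases "Z d x = 0")
    case True
    then show ?thesis using K(1) by (simp add: Z_def)
  next
    case False
    show ?thesis
    proof (cases "x = 0")
      case True
      then show ?thesis
        by (simp add: bounded_clinear_zero[OF B] bounded_clinear_zero[OF bounded_clinear_funpow[OF A]] As0)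
    next
      case x: False
      \<comment> \<open>test against the multiple of \<open>Z d x\<close> that has the norm of \<open>x\<close>\<close>
      define t where "t = norm x / norm (Z d x)"
      have t: "t > 0" "t * norm (Z d x) = norm x" using x False by (auto simp: t_def)
      define y where "y = complex_of_real t *\<^sub>C Z d x"
      have ny: "norm y = norm x" using t by (simp add: y_def norm_scaleC)
      have "cmod (cinner y (Z d x)) = t * (norm (Z d x) * norm (Z d x))"
        using t by (simp add: y_def cinner_scaleC_left norm_mult power2_eq_square flip: norm_cinner)
      also have "\<dots> = norm x * norm (Z d x)" using t(2) by (simp flip: mult.assoc)
      finally have "norm x * norm (Z d x) \<le> norm x * (K * norm x)"
        using form[of y x] by (simp add: ny power2_eq_square mult_ac)
      then show ?thesis using x by (simp add: Z_def)
    qed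
  qed
qed

section \<open>Operator-valued Laurent polynomials on the annulus\<close>

lemma funpow_norm_bound:
  fixes T :: "'a::real_normed_vector \<Rightarrow> 'a"
  assumes "\<And>x. norm (T x) \<le> r * norm x" "0 \<le> r"
  shows "norm ((T ^^ i) x) \<le> r ^ i * norm x"
proof (induction i)
  case (Suc i)
  have "norm (T ((T ^^ i) x)) \<le> r * (r ^ i * norm x)"
    using assms(1)[of "(T ^^ i) x"] mult_left_mono[OF Suc assms(2)] by linarith
  then show ?case by (simp add: mult.assoc)
qed simp

lemma funpow_scaleC:
  assumes "bounded_clinear T" shows "((\<lambda>x. c *\<^sub>C T x) ^^ i) x = (c ^ i) *\<^sub>C (T ^^ i) x"
  by (induction i arbitrary: x) (simp_all add: bounded_clinear_scaleC[OF assms] scaleC_scaleC)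

text \<open>The previous inequality for the contraction \<open>T / r\<close> and the coefficients \<open>r\<^sup>k F k\<close>. On the adjoint side
  the two rescalings do not cancel but combine to the factor \<open>r\<^sup>-\<^sup>2\<^sup>i\<close>.\<close>

lemma circle_von_Neumann:
  fixes T Ts :: "'a::complex_hilbert \<Rightarrow> 'a"
  assumes r: "r > 0" and T: "bounded_clinear T" and adj: "\<And>x y. cinner (T x) y = cinner x (Ts y)"
    and bound: "\<And>x. norm (T x) \<le> r * norm x"
    and F: "\<And>k. bounded_clinear (F k)"
    and comm: "\<And>k x. F k (T x) = T (F k x)" "\<And>k x. F k (Ts x) = Ts (F k x)"
    and supp: "\<And>k x. \<bar>k\<bar> > int d \<Longrightarrow> F k x = 0"
    and K: "K > 0" "\<And>z x. cmod z = r \<Longrightarrow> norm (Laurent_op d F z x) \<le> K * norm x"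
  shows "norm ((\<Sum>i\<le>d. F (int i) ((T ^^ i) x)) + (\<Sum>i\<le>d. complex_of_real (1 / r ^ (2 * i)) *\<^sub>C (Ts ^^ i) (F (- int i) x)) - F 0 x)
    \<le> K * norm x"
proof -
  have Ts: "bounded_clinear Ts" by (rule bounded_clinear_adjoint[of T Ts r]) (use adj bound in auto)
  define c where "c = complex_of_real (1 / r)"
  define B where "B = (\<lambda>k x. (complex_of_real r powi k) *\<^sub>C F k x)"
  have B: "bounded_clinear (B k)" for k
    using bounded_clinear_comp[OF bounded_clinear_scaleC_const F] by (simp add: B_def comp_def)
  have "norm ((\<Sum>i\<le>d. B (int i) (((\<lambda>x. c *\<^sub>C T x) ^^ i) x))
      + (\<Sum>i\<le>d. ((\<lambda>x. c *\<^sub>C Ts x) ^^ i) (B (- int i) x)) - B 0 x) \<le> K * norm x"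
  proof (rule harmonic_von_Neumann)
    show "bounded_clinear (\<lambda>x. c *\<^sub>C T x)"
      using bounded_clinear_comp[OF bounded_clinear_scaleC_const T] by (simp add: comp_def)
    show "cinner (c *\<^sub>C T x) y = cinner x (c *\<^sub>C Ts y)" for x y
      by (simp add: cinner_scaleC_left cinner_scaleC_right adj c_def)
    show "norm (c *\<^sub>C T x) \<le> norm x" for x
      using bound[of x] r by (simp add: norm_scaleC c_def field_simps norm_divide)
    show "bounded_clinear (B k)" for k by (rule B)
    show "B k (c *\<^sub>C T x) = c *\<^sub>C T (B k x)" "B k (c *\<^sub>C Ts x) = c *\<^sub>C Ts (B k x)" for k x
      by (simp_all add: bounded_clinear_scaleC[OF F] bounded_clinear_scaleC[OF T] bounded_clinear_scaleC[OF Ts]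
          B_def comm scaleC_scaleC mult.commute)
    show "B k x = 0" if "\<bar>k\<bar> > int d" for k x using supp[OF that] by (simp add: B_def)
    show "0 < K" by (rule K)
    show "norm (Laurent_op d B \<omega> x) \<le> K * norm x" if "cmod \<omega> = 1" for \<omega> x
    proof -
      have "Laurent_op d B \<omega> x = Laurent_op d F (\<omega> * complex_of_real r) x"
        by (simp add: Laurent_op_def B_def scaleC_scaleC power_int_mult_distrib)
      then show ?thesis using K(2)[of "\<omega> * complex_of_real r" x] that r by (simp add: norm_mult)
    qed
  qed
  moreover have "B (int i) (((\<lambda>x. c *\<^sub>C T x) ^^ i) x) = F (int i) ((T ^^ i) x)" for i
    using r by (simp add: B_def funpow_scaleC[OF T] bounded_clinear_scaleC[OF F] scaleC_scaleC c_def
        flip: power_mult_distrib of_real_mult)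
  moreover have "((\<lambda>x. c *\<^sub>C Ts x) ^^ i) (B (- int i) x) = complex_of_real (1 / r ^ (2 * i)) *\<^sub>C (Ts ^^ i) (F (- int i) x)" for i
    using r by (simp add: B_def funpow_scaleC[OF Ts] bounded_clinear_scaleC[OF bounded_clinear_funpow[OF Ts]]
         scaleC_scaleC c_def power_int_minus power_mult power2_eq_square divide_inverse power_mult_distrib power_inverse)
  moreover have "B 0 x = F 0 x" by (simp add: B_def)
  ultimately show ?thesis by simp
qed

text \<open>\<open>U1\<close> and \<open>U2\<close> are the operators that \<open>circle_von_Neumann\<close> controls on the outer circle, for \<open>T\<close>, and on
  the inner circle, for its inverse \<open>V\<close>. Their sum contains the wanted operator, one spare copy of \<open>F 0\<close>,
  and adjoint terms \<open>c1 i\<close>, \<open>c2 i\<close> of norm at most \<open>K r\<^sup>-\<^sup>2\<^sup>i\<close>, by the Cauchy estimates for the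
  coefficients. The constant is \<open>2\<close> for the circles, \<open>1\<close> for \<open>F 0\<close> and \<open>2 / (r\<^sup>2 - 1)\<close> for the two
  geometric series.\<close>

lemma annulus_operator_Laurent_bound:
  fixes T V Ts Vs :: "'a::complex_hilbert \<Rightarrow> 'a"
  assumes r: "r > 1"
    and T: "bounded_clinear T" "\<And>x y. cinner (T x) y = cinner x (Ts y)" "\<And>x. norm (T x) \<le> r * norm x"
    and V: "bounded_clinear V" "\<And>x y. cinner (V x) y = cinner x (Vs y)" "\<And>x. norm (V x) \<le> r * norm x"
    and F: "\<And>k. bounded_clinear (F k)"
    and commT: "\<And>k x. F k (T x) = T (F k x)" "\<And>k x. F k (Ts x) = Ts (F k x)"
    and commV: "\<And>k x. F k (V x) = V (F k x)" "\<And>k x. F k (Vs x) = Vs (F k x)"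
    and supp: "\<And>k x. \<bar>k\<bar> > int d \<Longrightarrow> F k x = 0"
    and K: "K > 0"
    and outer: "\<And>z x. cmod z = r \<Longrightarrow> norm (Laurent_op d F z x) \<le> K * norm x"
    and inner: "\<And>z x. cmod z = 1 / r \<Longrightarrow> norm (Laurent_op d F z x) \<le> K * norm x"
  shows "norm ((\<Sum>i\<le>d. F (int i) ((T ^^ i) x)) + (\<Sum>i\<le>d. F (- int i) ((V ^^ i) x)) - F 0 x)
    \<le> (3 * r\<^sup>2 - 1) / (r\<^sup>2 - 1) * K * norm x"
proof -
  have Laurent_uminus: "Laurent_op d (\<lambda>k. F (- k)) z x = Laurent_op d F (inverse z) x" for z x
    unfolding Laurent_op_def
    by (rule sum.reindex_bij_witness[of _ uminus uminus]) (auto simp: power_int_minus power_int_inverse)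
  define q where "q = (\<lambda>i. complex_of_real (1 / r ^ (2 * i)))"
  define U1 where "U1 = (\<Sum>i\<le>d. F (int i) ((T ^^ i) x)) + (\<Sum>i\<le>d. q i *\<^sub>C (Ts ^^ i) (F (- int i) x)) - F 0 x"
  define U2 where "U2 = (\<Sum>i\<le>d. F (- int i) ((V ^^ i) x)) + (\<Sum>i\<le>d. q i *\<^sub>C (Vs ^^ i) (F (int i) x)) - F 0 x"
  define c1 where "c1 = (\<lambda>i. q i *\<^sub>C (Ts ^^ i) (F (- int i) x))"
  define c2 where "c2 = (\<lambda>i. q i *\<^sub>C (Vs ^^ i) (F (int i) x))"
  have U1: "norm U1 \<le> K * norm x"
    unfolding U1_def q_def
    by (rule circle_von_Neumann) (use r T F commT supp K outer in auto)
  have U2: "norm U2 \<le> K * norm x"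
    unfolding U2_def q_def
    using circle_von_Neumann[of r V Vs "\<lambda>k. F (- k)" d K x] r V F commV supp K inner
    by (auto simp: Laurent_uminus norm_inverse inverse_eq_divide norm_divide)
  have coeff: "norm (F k x) * R powi k \<le> K * norm x"
    if "R > 0" and R: "\<And>z. cmod z = R \<Longrightarrow> norm (Laurent_op d F z x) \<le> K * norm x" for R k
  proof (cases "\<bar>k\<bar> \<le> int d")
    case True
    have "norm ((complex_of_real R powi k) *\<^sub>C F k x) \<le> K * norm x"
    proof (rule Laurent_coefficient_bound[OF True])
      fix \<omega> :: complex assume "cmod \<omega> = 1"
      then show "norm (\<Sum>k\<in>{- int d..int d}. (\<omega> powi k) *\<^sub>C (complex_of_real R powi k) *\<^sub>C F k x) \<le> K * norm x"
        using R[of "\<omega> * complex_of_real R"] that(1)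
        by (simp add: norm_mult Laurent_op_def scaleC_scaleC power_int_mult_distrib)
    qed
    then show ?thesis using that(1) by (simp add: norm_scaleC norm_power_int mult.commute)
  next
    case False
    then show ?thesis using supp[of k x] K by simp
  qed
  have small: "norm (q i *\<^sub>C (S ^^ i) y) \<le> K * norm x * (1 / r\<^sup>2) ^ i"
    if S: "\<And>x. norm (S x) \<le> r * norm x" and y: "norm y * r ^ i \<le> K * norm x" for i and S :: "'a \<Rightarrow> 'a" and y
  proof -
    have "norm (q i *\<^sub>C (S ^^ i) y) = norm ((S ^^ i) y) / r ^ (2 * i)"
      using r by (simp add: q_def norm_scaleC norm_divide norm_power)
    also have "\<dots> \<le> (r ^ i * norm y) / r ^ (2 * i)"
      using r by (intro divide_right_mono funpow_norm_bound S) auto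
    also have "\<dots> \<le> (K * norm x) / r ^ (2 * i)"
      using y r by (intro divide_right_mono) (auto simp: mult.commute)
    also have "\<dots> = K * norm x * (1 / r\<^sup>2) ^ i"
      by (simp add: power_mult power_divide)
    finally show ?thesis .
  qed
  have c1: "norm (c1 i) \<le> K * norm x * (1 / r\<^sup>2) ^ i" for i
    unfolding c1_def
  proof (rule small)
    show "norm (Ts x) \<le> r * norm x" for x by (rule adjoint_bound[of T]) (use T in auto)
    show "norm (F (- int i) x) * r ^ i \<le> K * norm x"
      using coeff[of "1 / r" "- int i"] inner r by (simp add: power_int_minus power_one_over divide_inverse power_inverse)
  qed
  have c2: "norm (c2 i) \<le> K * norm x * (1 / r\<^sup>2) ^ i" for i
    unfolding c2_def
  proof (rule small)
    show "norm (Vs x) \<le> r * norm x" for x by (rule adjoint_bound[of V]) (use V in auto)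
    show "norm (F (int i) x) * r ^ i \<le> K * norm x"
      using coeff[of r "int i"] outer r by simp
  qed
  have split0: "(\<Sum>i\<le>d. f i) = f 0 + (\<Sum>i\<in>{1..d}. f i)" for f :: "nat \<Rightarrow> 'a"
    by (simp add: atMost_atLeast0 sum.atLeast_Suc_atMost)
  have "(\<Sum>i\<le>d. F (int i) ((T ^^ i) x)) + (\<Sum>i\<le>d. F (- int i) ((V ^^ i) x)) - F 0 x
      = U1 + U2 - (F 0 x + (\<Sum>i\<in>{1..d}. c1 i + c2 i))"
    unfolding U1_def U2_def c1_def[symmetric] c2_def[symmetric] split0[of c1] split0[of c2]
    by (simp add: c1_def c2_def q_def sum.distrib algebra_simps)
  also have "norm \<dots> \<le> (norm U1 + norm U2) + (norm (F 0 x) + norm (\<Sum>i\<in>{1..d}. c1 i + c2 i))"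
    by (intro order_trans[OF norm_triangle_ineq4] add_mono norm_triangle_ineq)
  also have "\<dots> \<le> (K * norm x + K * norm x) + (K * norm x + 2 * (K * norm x) / (r\<^sup>2 - 1))"
  proof (intro add_mono U1 U2)
    show "norm (F 0 x) \<le> K * norm x" using coeff[of r 0] outer r by simp
    have r2: "r\<^sup>2 > 1" using r by (simp add: one_less_power)
    have "norm (\<Sum>i\<in>{1..d}. c1 i + c2 i) \<le> (\<Sum>i\<in>{1..d}. 2 * (K * norm x) * (1 / r\<^sup>2) ^ i)"
    proof (rule sum_norm_le)
      fix i
      show "norm (c1 i + c2 i) \<le> 2 * (K * norm x) * (1 / r\<^sup>2) ^ i"
        using norm_triangle_ineq[of "c1 i" "c2 i"] c1[of i] c2[of i] by simp
    qed
    also have "\<dots> = 2 * (K * norm x) * (\<Sum>i\<in>{1..d}. (1 / r\<^sup>2) ^ i)" by (simp add: sum_distrib_left)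
    also have "\<dots> \<le> 2 * (K * norm x) * (1 / (r\<^sup>2 - 1))"
    proof (intro mult_left_mono)
      have "(\<Sum>i\<in>{1..d}. (1 / r\<^sup>2) ^ i) = (1 / r\<^sup>2) * (\<Sum>i<d. (1 / r\<^sup>2) ^ i)"
        unfolding sum_distrib_left
        by (rule sum.reindex_bij_witness[of _ Suc "\<lambda>i. i - 1"]) (auto simp flip: power_Suc)
      also have "\<dots> \<le> (1 / r\<^sup>2) * (1 / (1 - 1 / r\<^sup>2))"
      proof (intro mult_left_mono)
        have u: "1 / r\<^sup>2 < 1" using r r2 by (subst pos_divide_less_eq) simp_all
        then have "(\<Sum>i<d. (1 / r\<^sup>2) ^ i) = (1 - (1 / r\<^sup>2) ^ d) / (1 - 1 / r\<^sup>2)"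
          by (subst sum_gp_strict) auto
        also have "\<dots> \<le> 1 / (1 - 1 / r\<^sup>2)"
          using u by (intro divide_right_mono) auto
        finally show "(\<Sum>i<d. (1 / r\<^sup>2) ^ i) \<le> 1 / (1 - 1 / r\<^sup>2)" .
      qed simp
      also have "\<dots> = 1 / (r\<^sup>2 - 1)" using r r2 by (simp add: field_simps)
      finally show "(\<Sum>i\<in>{1..d}. (1 / r\<^sup>2) ^ i) \<le> 1 / (r\<^sup>2 - 1)" .
    qed (use K in auto)
    finally show "norm (\<Sum>i\<in>{1..d}. c1 i + c2 i) \<le> 2 * (K * norm x) / (r\<^sup>2 - 1)" by simp
  qed
  also have "\<dots> = (3 * r\<^sup>2 - 1) / (r\<^sup>2 - 1) * K * norm x"
  proof -
    have "r\<^sup>2 - 1 \<noteq> 0" using r by (simp add: one_less_power less_imp_neq[symmetric])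
    then show ?thesis by (simp add: field_simps)
  qed
  finally show ?thesis .
qed

section \<open>Laurent polynomials of an operator tuple\<close>

text \<open>The graph of the functional calculus that sends a Laurent polynomial in \<open>n\<close> variables to its value at
  the tuple \<open>T\<close>. A relation is used instead of a map on coefficient families, so that sums, products and
  expansions in one variable need no reindexing. Factors \<open>inverse (z j)\<close> and \<open>z j\<close> are not cancelled; on functions
  this matters only at \<open>z j = 0\<close>.\<close>

inductive Laurent_calc ::
    "nat \<Rightarrow> (nat \<Rightarrow> 'a::complex_hilbert \<Rightarrow> 'a) \<Rightarrow> ((nat \<Rightarrow> complex) \<Rightarrow> complex) \<Rightarrow> ('a \<Rightarrow> 'a) \<Rightarrow> bool"
  for n T where
  const: "Laurent_calc n T (\<lambda>_. c) (\<lambda>x. c *\<^sub>C x)"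
| add: "Laurent_calc n T f S \<Longrightarrow> Laurent_calc n T g U \<Longrightarrow> Laurent_calc n T (\<lambda>z. f z + g z) (\<lambda>x. S x + U x)"
| var: "Laurent_calc n T f S \<Longrightarrow> j < n \<Longrightarrow> Laurent_calc n T (\<lambda>z. z j * f z) (\<lambda>x. T j (S x))"
| inv: "Laurent_calc n T f S \<Longrightarrow> j < n \<Longrightarrow> Laurent_calc n T (\<lambda>z. inverse (z j) * f z) (\<lambda>x. inv (T j) (S x))"

definition annulus_tuple :: "real \<Rightarrow> nat \<Rightarrow> (nat \<Rightarrow> 'a::complex_hilbert \<Rightarrow> 'a) \<Rightarrow> bool" where
  "annulus_tuple r n T \<longleftrightarrow> doubly_commuting n T \<and>
    (\<forall>j<n. invertible_op (T j) \<and> onorm (T j) \<le> r \<and> onorm (inv (T j)) \<le> r)"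

lemma annulus_tupleD:
  assumes "annulus_tuple r n T" "j < n"
  shows "bounded_clinear (T j)" "bounded_clinear (inv (T j))" "T j (inv (T j) x) = x" "inv (T j) (T j x) = x"
    "norm (T j x) \<le> r * norm x" "norm (inv (T j) x) \<le> r * norm x"
proof -
  have *: "invertible_op (T j)" "onorm (T j) \<le> r" "onorm (inv (T j)) \<le> r"
    using assms by (auto simp: annulus_tuple_def)
  then show 1: "bounded_clinear (T j)" and 2: "bounded_clinear (inv (T j))"
    by (auto simp: invertible_op_def)
  from * have "bij (T j)" by (simp add: invertible_op_def)
  then show "T j (inv (T j) x) = x" "inv (T j) (T j x) = x"
    by (simp_all add: bij_is_surj surj_f_inv_f bij_is_inj)
  show "norm (T j x) \<le> r * norm x"
    using bounded_clinear_bounded[OF 1, of x] * by (meson mult_right_mono norm_ge_zero order_trans)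
  show "norm (inv (T j) x) \<le> r * norm x"
    using bounded_clinear_bounded[OF 2, of x] * by (meson mult_right_mono norm_ge_zero order_trans)
qed

lemma annulus_tuple_Suc: "annulus_tuple r (Suc n) T \<Longrightarrow> annulus_tuple r n T"
  by (auto simp: annulus_tuple_def doubly_commuting_def)

lemma Laurent_calc_cong:
  assumes "Laurent_calc n T f S" "\<And>z. g z = f z" "\<And>x. U x = S x"
  shows "Laurent_calc n T g U"
proof -
  have "g = f" "U = S" using assms(2,3) by auto
  with assms(1) show ?thesis by simp
qed

lemma Laurent_calc_mono: "Laurent_calc n T f S \<Longrightarrow> n \<le> m \<Longrightarrow> Laurent_calc m T f S"
  by (induction rule: Laurent_calc.induct) (auto intro: Laurent_calc.intros)

lemma Laurent_calc_local: "Laurent_calc n T f S \<Longrightarrow> (\<And>j. j < n \<Longrightarrow> z j = w j) \<Longrightarrow> f z = f w"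
  by (induction rule: Laurent_calc.induct) auto

lemma Laurent_calc_bounded_clinear:
  assumes "Laurent_calc n T f S" "annulus_tuple r n T"
  shows "bounded_clinear S"
  using assms
proof (induction rule: Laurent_calc.induct)
  case (const c) show ?case by (rule bounded_clinear_scaleC_const)
next
  case (add f S g U) then show ?case by (intro bounded_clinear_plus)
next
  case (var f S j)
  then show ?case using bounded_clinear_comp[of "T j" S] annulus_tupleD(1) by (auto simp: comp_def)
next
  case (inv f S j)
  then show ?case using bounded_clinear_comp[of "inv (T j)" S] annulus_tupleD(2) by (auto simp: comp_def)
qed

text \<open>Applied with \<open>W\<close> an operator of the tuple, the adjoint of one, or another value of the calculus.\<close>

lemma Laurent_calc_commute:
  assumes "Laurent_calc n T f S" and W: "bounded_clinear W"
    and "\<And>j x. j < n \<Longrightarrow> T j (W x) = W (T j x)" "\<And>j x. j < n \<Longrightarrow> inv (T j) (W x) = W (inv (T j) x)"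
  shows "S (W x) = W (S x)"
  using assms(1)
  by (induction arbitrary: x rule: Laurent_calc.induct)
    (auto simp: bounded_clinear_add[OF W] bounded_clinear_scaleC[OF W] assms)

lemma Laurent_calc_scale:
  assumes "Laurent_calc n T f S" "annulus_tuple r n T"
  shows "Laurent_calc n T (\<lambda>z. c * f z) (\<lambda>x. c *\<^sub>C S x)"
  using assms(1)
proof (induction rule: Laurent_calc.induct)
  case (const c')
  show ?case by (rule Laurent_calc_cong[OF Laurent_calc.const[of n T "c * c'"]]) (auto simp: scaleC_scaleC)
next
  case (add f S g U)
  show ?case by (rule Laurent_calc_cong[OF Laurent_calc.add[OF add.IH]]) (auto simp: scaleC_add_right distrib_left)
next
  case (var f S j)
  show ?case using annulus_tupleD(1)[OF assms(2) var(2)]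
    by (intro Laurent_calc_cong[OF Laurent_calc.var[OF var.IH var(2)]]) (auto simp: bounded_clinear_scaleC)
next
  case (inv f S j)
  show ?case using annulus_tupleD(2)[OF assms(2) inv(2)]
    by (intro Laurent_calc_cong[OF Laurent_calc.inv[OF inv.IH inv(2)]]) (auto simp: bounded_clinear_scaleC)
qed

lemma Laurent_calc_mult:
  assumes "Laurent_calc n T f S" "Laurent_calc n T g U" "annulus_tuple r n T"
  shows "Laurent_calc n T (\<lambda>z. f z * g z) (\<lambda>x. S (U x))"
  using assms(1)
proof (induction rule: Laurent_calc.induct)
  case (const c)
  show ?case using Laurent_calc_scale[OF assms(2,3)] .
next
  case (add f1 S1 f2 S2)
  show ?case by (rule Laurent_calc_cong[OF Laurent_calc.add[OF add.IH]]) (auto simp: distrib_right)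
next
  case (var f S j)
  show ?case by (rule Laurent_calc_cong[OF Laurent_calc.var[OF var.IH var(2)]]) auto
next
  case (inv f S j)
  show ?case by (rule Laurent_calc_cong[OF Laurent_calc.inv[OF inv.IH inv(2)]]) auto
qed

lemma Laurent_calc_sum:
  assumes "\<And>i. i \<in> I \<Longrightarrow> Laurent_calc n T (f i) (S i)"
  shows "Laurent_calc n T (\<lambda>z. \<Sum>i\<in>I. f i z) (\<lambda>x. \<Sum>i\<in>I. S i x)"
  using assms
proof (induction I rule: infinite_finite_induct)
  case (insert i I)
  have "Laurent_calc n T (\<lambda>z. f i z + (\<Sum>i\<in>I. f i z)) (\<lambda>x. S i x + (\<Sum>i\<in>I. S i x))"
    by (rule Laurent_calc.add) (use insert in auto)
  then show ?case using insert.hyps by simp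
qed (use Laurent_calc.const[of n T 0] in auto)

definition opow :: "('a \<Rightarrow> 'a) \<Rightarrow> int \<Rightarrow> 'a \<Rightarrow> 'a" where
  "opow T k = (if 0 \<le> k then T ^^ nat k else (inv T) ^^ nat (- k))"

lemma opow_add1:
  assumes "\<And>x. T (inv T x) = x" shows "T (opow T k x) = opow T (k + 1) x"
proof (cases "0 \<le> k")
  case True then show ?thesis by (simp add: opow_def nat_add_distrib)
next
  case False
  define m where "m = nat (- k) - 1"
  have k: "k = - int (Suc m)" using False by (simp add: m_def)
  have "opow T (k + 1) x = (inv T ^^ m) x" unfolding k by (cases m) (auto simp: opow_def nat_add_distrib)
  moreover have "opow T k x = inv T ((inv T ^^ m) x)"
    unfolding k opow_def by (simp del: of_nat_Suc)
  ultimately show ?thesis using assms by simp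
qed

lemma opow_diff1:
  assumes "\<And>x. inv T (T x) = x" shows "inv T (opow T k x) = opow T (k - 1) x"
proof (cases "0 < k")
  case True
  then obtain m where k: "k = int (Suc m)" by (metis zero_less_imp_eq_int gr0_implies_Suc)
  have "opow T (k - 1) x = (T ^^ m) x" unfolding k by (simp add: opow_def)
  moreover have "opow T k x = T ((T ^^ m) x)" unfolding k by (simp add: opow_def nat_add_distrib)
  ultimately show ?thesis using assms by simp
next
  case False
  then obtain m where k: "k = - int m" by (metis int_cases of_nat_0_less_iff minus_zero of_nat_0 linorder_not_less neq0_conv)
  have "opow T (k - 1) x = (inv T ^^ Suc m) x" unfolding k by (simp add: opow_def nat_add_distrib)
  moreover have "opow T k x = (inv T ^^ m) x" unfolding k by (cases m) (auto simp: opow_def nat_add_distrib)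
  ultimately show ?thesis by simp
qed

lemma Laurent_calc_power:
  assumes "Laurent_calc n T f S" "j < n" "annulus_tuple r n T"
  shows "Laurent_calc n T (\<lambda>z. z j powi k * f z) (\<lambda>x. opow (T j) k (S x))"
proof -
  have 1: "Laurent_calc n T (\<lambda>z. z j ^ i * f z) (\<lambda>x. (T j ^^ i) (S x))" for i
  proof (induction i)
    case (Suc i) show ?case by (rule Laurent_calc_cong[OF Laurent_calc.var[OF Suc assms(2)]]) auto
  qed (use assms in simp)
  have 2: "Laurent_calc n T (\<lambda>z. inverse (z j) ^ i * f z) (\<lambda>x. (inv (T j) ^^ i) (S x))" for i
  proof (induction i)
    case (Suc i) show ?case by (rule Laurent_calc_cong[OF Laurent_calc.inv[OF Suc assms(2)]]) auto
  qed (use assms in simp)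
  show ?thesis using 1[of "nat k"] 2[of "nat (- k)"] by (simp add: opow_def power_int_def)
qed

lemma inverse_commute:
  assumes "\<And>x. A (A' x) = x" "\<And>x. A' (A x) = x" "\<And>x. A (B x) = B (A x)"
  shows "A' (B x) = B (A' x)"
  by (metis assms)

lemma annulus_tuple_commute:
  assumes "annulus_tuple r n T" "i < n" "j < n"
  shows "T i (T j x) = T j (T i x)" "T i (inv (T j) x) = inv (T j) (T i x)"
    "inv (T i) (T j x) = T j (inv (T i) x)" "inv (T i) (inv (T j) x) = inv (T j) (inv (T i) x)"
proof -
  note i = annulus_tupleD(3,4)[OF assms(1,2)] and j = annulus_tupleD(3,4)[OF assms(1,3)]
  show 1: "T i (T j x) = T j (T i x)" for x
    using assms by (cases "i = j") (auto simp: annulus_tuple_def doubly_commuting_def fun_eq_iff)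
  show 2: "T i (inv (T j) x) = inv (T j) (T i x)" for x
    using inverse_commute[of "T j" "inv (T j)" "T i" x] j 1 by simp
  show 3: "inv (T i) (T j x) = T j (inv (T i) x)" for x
    using inverse_commute[of "T i" "inv (T i)" "T j" x] i 1 by simp
  show "inv (T i) (inv (T j) x) = inv (T j) (inv (T i) x)"
    using inverse_commute[of "T i" "inv (T i)" "inv (T j)" x] i 2 by simp
qed

text \<open>Double commutativity is assumed for the operators themselves; it passes to inverses and to the
  adjoints of inverses because \<open>cadjoint (inv T)\<close> inverts \<open>cadjoint T\<close>.\<close>

lemma annulus_tuple_commute_adjoint:
  assumes "annulus_tuple r n T" "i < n" "j < n" "i \<noteq> j"
  shows "T i (cadjoint (T j) x) = cadjoint (T j) (T i x)"
    "inv (T i) (cadjoint (T j) x) = cadjoint (T j) (inv (T i) x)"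
    "T i (cadjoint (inv (T j)) x) = cadjoint (inv (T j)) (T i x)"
    "inv (T i) (cadjoint (inv (T j)) x) = cadjoint (inv (T j)) (inv (T i) x)"
proof -
  note i = annulus_tupleD[OF assms(1,2)] and j = annulus_tupleD[OF assms(1,3)]
  show 1: "T i (cadjoint (T j) x) = cadjoint (T j) (T i x)" for x
    using assms by (auto simp: annulus_tuple_def doubly_commuting_def fun_eq_iff)
  show 2: "inv (T i) (cadjoint (T j) x) = cadjoint (T j) (inv (T i) x)" for x
    using inverse_commute[of "T i" "inv (T i)" "cadjoint (T j)" x] i 1 by simp
  have adj: "cadjoint (T j) (cadjoint (inv (T j)) x) = x" "cadjoint (inv (T j)) (cadjoint (T j) x) = x" for x
    by (rule cinner_ext; simp add: cinner_cadjoint[OF j(1), symmetric] cinner_cadjoint[OF j(2), symmetric] j)+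
  show "T i (cadjoint (inv (T j)) x) = cadjoint (inv (T j)) (T i x)"
    using inverse_commute[of "cadjoint (T j)" "cadjoint (inv (T j))" "T i" x] adj 1 by simp
  show "inv (T i) (cadjoint (inv (T j)) x) = cadjoint (inv (T j)) (inv (T i) x)"
    using inverse_commute[of "cadjoint (T j)" "cadjoint (inv (T j))" "inv (T i)" x] adj 2 by simp
qed

lemma Laurent_calc_0: "Laurent_calc 0 T f S \<Longrightarrow> \<exists>c. (\<forall>z. f z = c) \<and> (\<forall>x. S x = c *\<^sub>C x)"
  by (induction rule: Laurent_calc.induct) (auto simp: scaleC_add_left)

text \<open>Expansion in powers of the last variable, with coefficients in the calculus of the other variables.
  The restriction to \<open>z n \<noteq> 0\<close> is where \<open>z n\<close> and \<open>inverse (z n)\<close> do cancel.\<close>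

lemma Laurent_calc_expand_last_aux:
  assumes "Laurent_calc (Suc n) T f S" and tup: "annulus_tuple r (Suc n) T"
  shows "\<exists>I F G. finite I \<and> (\<forall>k. Laurent_calc n T (F k) (G k))
    \<and> (\<forall>z. z n \<noteq> 0 \<longrightarrow> f z = (\<Sum>k\<in>I. z n powi k * F k z))
    \<and> (\<forall>x. S x = (\<Sum>k\<in>I. G k (opow (T n) k x)))"
  using assms(1)
proof (induction rule: Laurent_calc.induct)
  case (const c)
  show ?case
    by (rule exI[of _ "{0}"], rule exI[of _ "\<lambda>_ _. c"], rule exI[of _ "\<lambda>_ x. c *\<^sub>C x"])
      (auto simp: opow_def intro: Laurent_calc.const)
next
  case (add f S g U)
  then obtain I F G J F' G' where
    1: "finite I" "\<And>k. Laurent_calc n T (F k) (G k)"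
      "\<And>z. z n \<noteq> 0 \<Longrightarrow> f z = (\<Sum>k\<in>I. z n powi k * F k z)" "\<And>x. S x = (\<Sum>k\<in>I. G k (opow (T n) k x))"
    and 2: "finite J" "\<And>k. Laurent_calc n T (F' k) (G' k)"
      "\<And>z. z n \<noteq> 0 \<Longrightarrow> g z = (\<Sum>k\<in>J. z n powi k * F' k z)" "\<And>x. U x = (\<Sum>k\<in>J. G' k (opow (T n) k x))"
    by blast
  define F2 where "F2 = (\<lambda>k z. (if k \<in> I then F k z else 0) + (if k \<in> J then F' k z else 0))"
  define G2 where "G2 = (\<lambda>k x. (if k \<in> I then G k x else 0) + (if k \<in> J then G' k x else 0))"
  have restr1: "(\<Sum>k\<in>I \<union> J. if k \<in> I then h k else 0) = sum h I" "(\<Sum>k\<in>I \<union> J. if k \<in> J then h k else 0) = sum h J"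
    for h :: "int \<Rightarrow> 'b::comm_monoid_add"
    using 1(1) 2(1) by (simp_all add: sum.inter_restrict[symmetric] Int_absorb1 Int_absorb2)
  have zero: "Laurent_calc n T (\<lambda>_. 0) (\<lambda>_. 0)" using Laurent_calc.const[of n T 0] by simp
  have "Laurent_calc n T (F2 k) (G2 k)" for k
    unfolding F2_def G2_def using 1(2)[of k] 2(2)[of k] zero
    by (intro Laurent_calc.add) (cases "k \<in> I"; cases "k \<in> J"; simp)+
  moreover have "f z + g z = (\<Sum>k\<in>I \<union> J. z n powi k * F2 k z)" if "z n \<noteq> 0" for z
    using restr1(1)[of "\<lambda>k. z n powi k * F k z"] restr1(2)[of "\<lambda>k. z n powi k * F' k z"] 1(3)[of z] 2(3)[of z] that
    by (simp add: F2_def distrib_left sum.distrib if_distrib[of "\<lambda>y. _ * y"] cong: if_cong)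
  moreover have "S x + U x = (\<Sum>k\<in>I \<union> J. G2 k (opow (T n) k x))" for x
    using restr1(1)[of "\<lambda>k. G k (opow (T n) k x)"] restr1(2)[of "\<lambda>k. G' k (opow (T n) k x)"] 1(4)[of x] 2(4)[of x]
    by (simp add: G2_def sum.distrib)
  ultimately show ?case using 1(1) 2(1) by (intro exI[of _ "I \<union> J"] exI[of _ F2] exI[of _ G2]) auto
next
  case (var f S j)
  then obtain I F G where
    1: "finite I" "\<And>k. Laurent_calc n T (F k) (G k)"
      "\<And>z. z n \<noteq> 0 \<Longrightarrow> f z = (\<Sum>k\<in>I. z n powi k * F k z)" "\<And>x. S x = (\<Sum>k\<in>I. G k (opow (T n) k x))"
    by blast
  note Tj = annulus_tupleD[OF tup var(2)]
  show ?case
  proof (cases "j = n")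
    case False
    with var have j: "j < n" by simp
    show ?thesis
      by (rule exI[of _ I], rule exI[of _ "\<lambda>k z. z j * F k z"], rule exI[of _ "\<lambda>k x. T j (G k x)"])
        (auto simp: 1 sum_distrib_left mult_ac bounded_clinear_sum[OF Tj(1)] intro: Laurent_calc.var[OF _ j])
  next
    case True
    have comm: "G k (T n x) = T n (G k x)" for k x
      by (rule Laurent_calc_commute[OF 1(2) annulus_tupleD(1)[OF tup]])
        (auto intro: annulus_tuple_commute[OF tup])
    have "T n (S x) = (\<Sum>k\<in>(\<lambda>k. k + 1) ` I. G (k - 1) (opow (T n) k x))" for x
      using Tj by (simp add: 1(4) True bounded_clinear_sum opow_add1 flip: comm)
        (simp add: sum.reindex inj_on_def)
    moreover have "z n * f z = (\<Sum>k\<in>(\<lambda>k. k + 1) ` I. z n powi k * F (k - 1) z)" if "z n \<noteq> 0" for z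
      using that by (simp add: 1(3) sum.reindex inj_on_def sum_distrib_left power_int_add mult_ac)
    ultimately show ?thesis unfolding True using 1
      by (intro exI[of _ "(\<lambda>k. k + 1) ` I"] exI[of _ "\<lambda>k. F (k - 1)"] exI[of _ "\<lambda>k. G (k - 1)"]) auto
  qed
next
  case (inv f S j)
  then obtain I F G where
    1: "finite I" "\<And>k. Laurent_calc n T (F k) (G k)"
      "\<And>z. z n \<noteq> 0 \<Longrightarrow> f z = (\<Sum>k\<in>I. z n powi k * F k z)" "\<And>x. S x = (\<Sum>k\<in>I. G k (opow (T n) k x))"
    by blast
  note Tj = annulus_tupleD[OF tup inv(2)]
  show ?case
  proof (cases "j = n")
    case False
    with inv have j: "j < n" by simp
    show ?thesis
      by (rule exI[of _ I], rule exI[of _ "\<lambda>k z. inverse (z j) * F k z"], rule exI[of _ "\<lambda>k x. inv (T j) (G k x)"])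
        (auto simp: 1 sum_distrib_left mult.left_commute bounded_clinear_sum[OF Tj(2)] intro: Laurent_calc.inv[OF _ j])
  next
    case True
    have comm: "G k (inv (T n) x) = inv (T n) (G k x)" for k x
      by (rule Laurent_calc_commute[OF 1(2) annulus_tupleD(2)[OF tup]])
        (auto intro: annulus_tuple_commute[OF tup])
    have "inv (T n) (S x) = (\<Sum>k\<in>(\<lambda>k. k - 1) ` I. G (k + 1) (opow (T n) k x))" for x
      using Tj by (simp add: 1(4) True bounded_clinear_sum opow_diff1 flip: comm)
        (simp add: sum.reindex inj_on_def)
    moreover have "inverse (z n) * f z = (\<Sum>k\<in>(\<lambda>k. k - 1) ` I. z n powi k * F (k + 1) z)" if "z n \<noteq> 0" for z
      using that by (simp add: 1(3) sum.reindex inj_on_def sum_distrib_left power_int_diff field_simps)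
    ultimately show ?thesis unfolding True using 1
      by (intro exI[of _ "(\<lambda>k. k - 1) ` I"] exI[of _ "\<lambda>k. F (k + 1)"] exI[of _ "\<lambda>k. G (k + 1)"]) auto
  qed
qed

lemma Laurent_calc_expand_last:
  assumes "Laurent_calc (Suc n) T f S" and tup: "annulus_tuple r (Suc n) T"
  obtains d F G where "\<And>k. Laurent_calc n T (F k) (G k)"
    "\<And>k x. \<bar>k\<bar> > int d \<Longrightarrow> G k x = 0"
    "\<And>z. z n \<noteq> 0 \<Longrightarrow> f z = (\<Sum>k\<in>{- int d..int d}. z n powi k * F k z)"
    "\<And>x. S x = (\<Sum>k\<in>{- int d..int d}. G k (opow (T n) k x))"
proof -
  from Laurent_calc_expand_last_aux[OF assms] obtain I F G where
    1: "finite I" "\<And>k. Laurent_calc n T (F k) (G k)"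
      "\<And>z. z n \<noteq> 0 \<Longrightarrow> f z = (\<Sum>k\<in>I. z n powi k * F k z)" "\<And>x. S x = (\<Sum>k\<in>I. G k (opow (T n) k x))"
    by blast
  define d where "d = nat (\<Sum>k\<in>I. \<bar>k\<bar>)"
  have sub: "I \<subseteq> {- int d..int d}"
  proof
    fix k assume "k \<in> I"
    then have "\<bar>k\<bar> \<le> (\<Sum>k\<in>I. \<bar>k\<bar>)" using 1(1) by (intro member_le_sum) auto
    moreover have "(\<Sum>k\<in>I. \<bar>k\<bar>) \<ge> 0" by (simp add: sum_nonneg)
    ultimately show "k \<in> {- int d..int d}" unfolding d_def by auto
  qed
  have zero: "Laurent_calc n T (\<lambda>_. 0) (\<lambda>_. 0)" using Laurent_calc.const[of n T 0] by simp
  show thesis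
  proof (rule that[of "\<lambda>k z. if k \<in> I then F k z else 0" "\<lambda>k x. if k \<in> I then G k x else 0" d])
    show "Laurent_calc n T (\<lambda>z. if k \<in> I then F k z else 0) (\<lambda>x. if k \<in> I then G k x else 0)" for k
      using 1(2)[of k] zero by (cases "k \<in> I") auto
    show "(if k \<in> I then G k x else 0) = 0" if "\<bar>k\<bar> > int d" for k x using that subsetD[OF sub, of k] by auto
    show "f z = (\<Sum>k\<in>{- int d..int d}. z n powi k * (if k \<in> I then F k z else 0))" if "z n \<noteq> 0" for z
      unfolding 1(3)[of z, OF that] by (rule sum.mono_neutral_cong_left) (use sub in auto)
    show "S x = (\<Sum>k\<in>{- int d..int d}. if k \<in> I then G k (opow (T n) k x) else 0)" for x
      unfolding 1(4) by (rule sum.mono_neutral_cong_left) (use sub in auto)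
  qed
qed

lemma sum_symmetric_interval:
  fixes h :: "int \<Rightarrow> 'b::ab_group_add"
  shows "(\<Sum>k\<in>{- int d..int d}. h k) = (\<Sum>i\<le>d. h (int i)) + (\<Sum>i\<le>d. h (- int i)) - h 0"
proof (induction d)
  case (Suc d)
  have "{- int (Suc d)..int (Suc d)} = insert (- int (Suc d)) (insert (int (Suc d)) {- int d..int d})" by auto
  then show ?case using Suc by (simp add: algebra_simps)
qed simp

definition polyannulus :: "nat \<Rightarrow> real \<Rightarrow> (nat \<Rightarrow> complex) set" where
  "polyannulus n r = {z. \<forall>j<n. 1 / r \<le> cmod (z j) \<and> cmod (z j) \<le> r}"

text \<open>For a fixed value \<open>w\<close> of the last variable, the expansion is a Laurent polynomial in the other variables,
  so the induction hypothesis bounds the operator \<open>\<Sum>k. w\<^sup>k G k\<close> by \<open>C\<^sup>n K\<close>. These are the values of an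
  operator-valued Laurent polynomial whose coefficients doubly commute with the last operator, and
  \<open>annulus_operator_Laurent_bound\<close> contributes the last factor \<open>C\<close>.\<close>

theorem Laurent_calc_bound:
  fixes T :: "nat \<Rightarrow> 'a::complex_hilbert \<Rightarrow> 'a"
  assumes "Laurent_calc n T f S" and "annulus_tuple r n T" and r: "r > 1" and K: "K > 0"
    and "\<And>z. z \<in> polyannulus n r \<Longrightarrow> cmod (f z) \<le> K"
  shows "norm (S x) \<le> ((3 * r\<^sup>2 - 1) / (r\<^sup>2 - 1)) ^ n * K * norm x"
  using assms(1,2,5)
proof (induction n arbitrary: f S x)
  case 0
  from Laurent_calc_0[OF 0(1)] obtain c where c: "\<And>z. f z = c" "\<And>x. S x = c *\<^sub>C x" by blast
  show ?case using 0(3)[of "\<lambda>_. 0"] by (simp add: polyannulus_def c norm_scaleC mult_right_mono)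
next
  case (Suc n)
  let ?C = "(3 * r\<^sup>2 - 1) / (r\<^sup>2 - 1)"
  have "r\<^sup>2 > 1" using r by (simp add: one_less_power)
  then have C: "?C > 0" by simp
  note tup = Suc.prems(2) and tup' = annulus_tuple_Suc[OF Suc.prems(2)]
  note Tn = annulus_tupleD[OF tup lessI]
  obtain d F G where FG: "\<And>k. Laurent_calc n T (F k) (G k)"
    and supp: "\<And>k x. \<bar>k\<bar> > int d \<Longrightarrow> G k x = 0"
    and f: "\<And>z. z n \<noteq> 0 \<Longrightarrow> f z = (\<Sum>k\<in>{- int d..int d}. z n powi k * F k z)"
    and S: "\<And>x. S x = (\<Sum>k\<in>{- int d..int d}. G k (opow (T n) k x))"
    by (rule Laurent_calc_expand_last[OF Suc.prems(1) tup], rule that)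
  have slice: "norm (Laurent_op d G w x) \<le> ?C ^ n * K * norm x" if w: "1 / r \<le> cmod w" "cmod w \<le> r" for w x
    unfolding Laurent_op_def
  proof (rule Suc.IH[OF Laurent_calc_sum tup'])
    show "Laurent_calc n T (\<lambda>z. w powi k * F k z) (\<lambda>x. (w powi k) *\<^sub>C G k x)" for k
      by (rule Laurent_calc_scale[OF FG tup'])
    fix z assume z: "z \<in> polyannulus n r"
    have "w \<noteq> 0" using w r by (auto simp: divide_le_0_iff)
    have "F k (z(n := w)) = F k z" for k by (rule Laurent_calc_local[OF FG]) auto
    then have "(\<Sum>k\<in>{- int d..int d}. w powi k * F k z) = f (z(n := w))"
      using f[of "z(n := w)"] \<open>w \<noteq> 0\<close> by simp
    also have "cmod \<dots> \<le> K" using z w by (intro Suc.prems(3)) (auto simp: polyannulus_def less_Suc_eq)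
    finally show "cmod (\<Sum>k\<in>{- int d..int d}. w powi k * F k z) \<le> K" .
  qed
  have comm: "G k (W x) = W (G k x)"
    if "bounded_clinear W" "\<And>j x. j < n \<Longrightarrow> T j (W x) = W (T j x)"
      "\<And>j x. j < n \<Longrightarrow> inv (T j) (W x) = W (inv (T j) x)" for W k x
    by (rule Laurent_calc_commute[OF FG that])
  have adj_bounded: "bounded_clinear (cadjoint (T n))" "bounded_clinear (cadjoint (inv (T n)))"
    using bounded_clinear_adjoint[OF cinner_cadjoint[OF Tn(1)] Tn(5)]
      bounded_clinear_adjoint[OF cinner_cadjoint[OF Tn(2)] Tn(6)] by auto
  have "norm ((\<Sum>i\<le>d. G (int i) ((T n ^^ i) x)) + (\<Sum>i\<le>d. G (- int i) ((inv (T n) ^^ i) x)) - G 0 x)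
      \<le> ?C * (?C ^ n * K) * norm x"
  proof (rule annulus_operator_Laurent_bound[OF r Tn(1) cinner_cadjoint[OF Tn(1)] Tn(5) Tn(2) cinner_cadjoint[OF Tn(2)] Tn(6)])
    show "bounded_clinear (G k)" for k by (rule Laurent_calc_bounded_clinear[OF FG tup'])
    show "G k (T n x) = T n (G k x)" "G k (inv (T n) x) = inv (T n) (G k x)" for k x
      by (rule comm[OF Tn(1)] comm[OF Tn(2)]; auto intro: annulus_tuple_commute[OF tup])+
    show "G k (cadjoint (T n) x) = cadjoint (T n) (G k x)"
      "G k (cadjoint (inv (T n)) x) = cadjoint (inv (T n)) (G k x)" for k x
      by (rule comm[OF adj_bounded(1)] comm[OF adj_bounded(2)]; auto intro: annulus_tuple_commute_adjoint[OF tup])+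
    show "G k x = 0" if "int d < \<bar>k\<bar>" for k x by (rule supp[OF that])
    show "0 < ?C ^ n * K" using C K by simp
    have "1 / r \<le> r" using r by (meson divide_le_eq_1_pos less_le_trans less_imp_le order_trans zero_less_one)
    then show "norm (Laurent_op d G z x) \<le> ?C ^ n * K * norm x" if "cmod z = r" for z x
      using slice[of z x] that by simp
    show "norm (Laurent_op d G z x) \<le> ?C ^ n * K * norm x" if "cmod z = 1 / r" for z x
      using slice[of z x] that \<open>1 / r \<le> r\<close> by simp
  qed
  also have "(\<Sum>i\<le>d. G (int i) ((T n ^^ i) x)) + (\<Sum>i\<le>d. G (- int i) ((inv (T n) ^^ i) x)) - G 0 x = S x"
  proof -
    have "opow (T n) (- int i) = inv (T n) ^^ i" for i by (cases i) (auto simp: opow_def nat_add_distrib)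
    moreover have "opow (T n) (int i) = T n ^^ i" "opow (T n) 0 = id" for i by (auto simp: opow_def)
    ultimately show ?thesis unfolding S sum_symmetric_interval by simp
  qed
  finally show ?case by (simp add: mult.assoc)
qed

section \<open>Uniform approximation by Laurent polynomials\<close>

lemma open_annulus: "open (annulus R)"
proof -
  have "annulus R = {z. inverse R < cmod z} \<inter> {z. cmod z < R}" by (auto simp: annulus_def)
  then show ?thesis by (simp add: open_Int open_Collect_less continuous_on_norm_id)
qed

lemma homotopic_circles_in_annulus:
  assumes "1 < \<rho>" "\<rho> < R"
  shows "homotopic_loops (annulus R) (circlepath 0 \<rho>) (circlepath 0 (1 / \<rho>))"
proof (rule homotopic_loops_linear)
  fix t :: real
  let ?e = "exp (2 * of_real pi * \<i> * of_real t)"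
  show "closed_segment (circlepath 0 \<rho> t) (circlepath 0 (1 / \<rho>) t) \<subseteq> annulus R"
  proof
    fix z assume "z \<in> closed_segment (circlepath 0 \<rho> t) (circlepath 0 (1 / \<rho>) t)"
    then obtain u where u: "0 \<le> u" "u \<le> 1"
      and z: "z = (1 - u) *\<^sub>R circlepath 0 \<rho> t + u *\<^sub>R circlepath 0 (1 / \<rho>) t"
      by (auto simp: in_segment)
    define s where "s = (1 - u) * \<rho> + u * (1 / \<rho>)"
    have "z = of_real s * ?e"
      unfolding z circlepath s_def by (simp add: scaleR_conv_of_real algebra_simps)
    then have nz: "cmod z = \<bar>s\<bar>" by (simp add: norm_mult norm_exp_eq_Re)
    have lt: "1 / \<rho> < \<rho>" using assms by (metis divide_less_eq_1_pos less_trans zero_less_one)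
    have "s - 1 / \<rho> = (1 - u) * (\<rho> - 1 / \<rho>)" "\<rho> - s = u * (\<rho> - 1 / \<rho>)"
      using assms by (simp_all add: s_def field_simps)
    moreover have "0 \<le> (1 - u) * (\<rho> - 1 / \<rho>)" "0 \<le> u * (\<rho> - 1 / \<rho>)"
      using u lt by simp_all
    ultimately have "0 \<le> s - 1 / \<rho>" "0 \<le> \<rho> - s" by metis+
    then have s: "1 / \<rho> \<le> s" "s \<le> \<rho>" by simp_all
    have "inverse R < 1 / \<rho>" using assms by (simp add: inverse_eq_divide frac_less2)
    moreover have "0 < 1 / \<rho>" using assms by simp
    ultimately have "inverse R < cmod z" "cmod z < R" using s assms(2) nz by linarith+
    then show "z \<in> annulus R" by (simp add: annulus_def)
  qed
qed simp_all

text \<open>The difference quotient of \<open>f\<close> at \<open>w\<close> extends holomorphically over \<open>w\<close>, so its integrals over the two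
  homotopic circles agree; the kernel \<open>1 / (z - w)\<close> has integral \<open>2 \<pi> \<i>\<close> over the outer circle and \<open>0\<close>
  over the inner one.\<close>

lemma Cauchy_integral_annulus:
  assumes f: "f holomorphic_on annulus R" and \<rho>: "1 < \<rho>" "\<rho> < R" and w: "1 / \<rho> < cmod w" "cmod w < \<rho>"
  obtains I J where "((\<lambda>z. f z / (z - w)) has_contour_integral I) (circlepath 0 \<rho>)"
    "((\<lambda>z. f z / (z - w)) has_contour_integral J) (circlepath 0 (1 / \<rho>))"
    "I - J = 2 * of_real pi * \<i> * f w"
proof -
  have pos: "0 < 1 / \<rho>" using \<rho> by simp
  have inR: "inverse R < 1 / \<rho>" using \<rho> by (simp add: inverse_eq_divide frac_less2)
  have lt: "1 / \<rho> < \<rho>" using \<rho> by (metis divide_less_eq_1_pos less_trans zero_less_one)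
  define F where "F = (\<lambda>z. if z = w then deriv f w else (f z - f w) / (z - w))"
  have "w \<in> annulus R" using w inR \<rho> by (auto simp: annulus_def)
  then have F: "F holomorphic_on annulus R"
    unfolding F_def using f open_annulus by (intro pole_lemma) (auto simp: interior_open)
  have eq: "contour_integral (circlepath 0 \<rho>) F = contour_integral (circlepath 0 (1 / \<rho>)) F"
    by (rule Cauchy_theorem_homotopic_loops[OF homotopic_circles_in_annulus[OF \<rho>] open_annulus F]) simp_all
  have circ: "path_image (circlepath 0 s) \<subseteq> annulus R" if "s = \<rho> \<or> s = 1 / \<rho>" for s
    using that \<rho> lt inR pos by (auto simp: annulus_def)
  have int: "(F has_contour_integral contour_integral (circlepath 0 s) F) (circlepath 0 s)"
    if "s = \<rho> \<or> s = 1 / \<rho>" for s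
    by (intro has_contour_integral_integral contour_integrable_holomorphic_simple[OF F open_annulus _ circ[OF that]]) simp
  define c where "c = contour_integral (circlepath 0 \<rho>) F"
  have intO: "(F has_contour_integral c) (circlepath 0 \<rho>)" and intI: "(F has_contour_integral c) (circlepath 0 (1 / \<rho>))"
    using int[of \<rho>] int[of "1 / \<rho>"] eq by (auto simp: c_def)
  have outer: "((\<lambda>z. f w / (z - w)) has_contour_integral (2 * of_real pi * \<i> * f w)) (circlepath 0 \<rho>)"
    using w by (intro Cauchy_integral_circlepath) auto
  have inner: "((\<lambda>z. f w / (z - w)) has_contour_integral 0) (circlepath 0 (1 / \<rho>))"
    by (rule Cauchy_theorem_disc_simple[of _ 0 "cmod w"]) (use w pos in \<open>auto intro!: holomorphic_intros\<close>)
  have split: "F z + f w / (z - w) = f z / (z - w)" if "z \<in> path_image (circlepath 0 s)" "s = \<rho> \<or> s = 1 / \<rho>" for z s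
  proof -
    have "cmod z = s" using that pos \<rho> by auto
    then have "z \<noteq> w" using that(2) w by auto
    then show ?thesis by (simp add: F_def diff_divide_distrib)
  qed
  have "((\<lambda>z. f z / (z - w)) has_contour_integral (c + 2 * of_real pi * \<i> * f w)) (circlepath 0 \<rho>)"
    by (rule has_contour_integral_eq[OF has_contour_integral_add[OF intO outer]]) (rule split, auto)
  moreover have "((\<lambda>z. f z / (z - w)) has_contour_integral (c + 0)) (circlepath 0 (1 / \<rho>))"
    by (rule has_contour_integral_eq[OF has_contour_integral_add[OF intI inner]]) (rule split[of _ "1 / \<rho>"], auto)
  ultimately show thesis by (rule that) simp
qed

text \<open>Expand the Cauchy kernel into a finite geometric sum with remainder: in powers of \<open>w / z\<close> on the outer
  circle and of \<open>z / w\<close> on the inner one. The remainder bound does not depend on \<open>f\<close> beyond \<open>M\<close>, and the same coefficients serve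
  all sub-annuli \<open>t < \<rho>\<close>.\<close>

lemma annulus_Laurent_truncation:
  assumes f: "f holomorphic_on annulus R" and \<rho>: "1 < \<rho>" "\<rho> < R" and M: "\<And>z. z \<in> annulus R \<Longrightarrow> cmod (f z) \<le> M"
  obtains a where "\<And>t w. 1 \<le> t \<Longrightarrow> t < \<rho> \<Longrightarrow> 1 / t \<le> cmod w \<Longrightarrow> cmod w \<le> t \<Longrightarrow>
    cmod (f w - (\<Sum>k\<in>{- int m..int m}. a k * w powi k)) \<le> 2 * M * (t / \<rho>) ^ m * \<rho> / (\<rho> - t)"
proof -
  let ?O = "circlepath 0 \<rho>" and ?I = "circlepath 0 (1 / \<rho>)"
  have pos: "0 < 1 / \<rho>" using \<rho> by simp
  have inR: "inverse R < 1 / \<rho>" using \<rho> by (simp add: inverse_eq_divide frac_less2)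
  have lt: "1 / \<rho> < \<rho>" using \<rho> by (metis divide_less_eq_1_pos less_trans zero_less_one)
  have onO: "z \<in> annulus R" "z \<noteq> 0" if "cmod z = \<rho>" for z using that \<rho> lt inR by (auto simp: annulus_def)
  have onI: "z \<in> annulus R" "z \<noteq> 0" if "cmod z = 1 / \<rho>" for z using that \<rho> lt inR by (auto simp: annulus_def)
  have M0: "0 \<le> M" using M[OF onO(1)[of "of_real \<rho>"]] \<rho> norm_ge_zero order_trans by (metis abs_of_pos less_trans norm_of_real zero_less_one)
  have sub: "path_image ?O \<subseteq> annulus R - {0}" "path_image ?I \<subseteq> annulus R - {0}"
    using onO onI \<rho> by auto
  have op: "open (annulus R - {0})" by (intro open_delete open_annulus)
  define coef where "coef = (\<lambda>k p. contour_integral p (\<lambda>z. f z * z powi (- k - 1)) / (2 * of_real pi * \<i>))"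
  have coef: "((\<lambda>z. f z * z powi (- k - 1)) has_contour_integral (2 * of_real pi * \<i> * coef k p)) p"
    if "p = ?O \<or> p = ?I" for k p
  proof -
    have "(\<lambda>z. f z * z powi (- k - 1)) holomorphic_on (annulus R - {0})"
      by (intro holomorphic_intros holomorphic_on_subset[OF f]) auto
    then have "(\<lambda>z. f z * z powi (- k - 1)) contour_integrable_on p"
      by (rule contour_integrable_holomorphic_simple[OF _ op]) (use that sub in auto)
    then show ?thesis by (simp add: coef_def has_contour_integral_integral)
  qed
  define a where "a = (\<lambda>k. if 0 \<le> k then coef k ?O else coef k ?I)"
  show thesis
  proof (rule that[of a])
    fix t w assume t: "1 \<le> t" "t < \<rho>" and w: "1 / t \<le> cmod w" "cmod w \<le> t"
    have w0: "w \<noteq> 0" using w t by (auto simp: divide_le_0_iff)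
    have tr: "1 / \<rho> < 1 / t" using t by (simp add: frac_less2)
    obtain I J where IJ: "((\<lambda>z. f z / (z - w)) has_contour_integral I) ?O"
      "((\<lambda>z. f z / (z - w)) has_contour_integral J) ?I" "I - J = 2 * of_real pi * \<i> * f w"
    proof (rule Cauchy_integral_annulus[OF f \<rho>, of w])
      show "1 / \<rho> < cmod w" "cmod w < \<rho>" using w t tr by linarith+
    qed (rule that)
    define P where "P = (\<Sum>i\<le>m. coef (int i) ?O * w ^ i)"
    define N where "N = (\<Sum>i\<in>{1..m}. coef (- int i) ?I * inverse w ^ i)"
    have geo: "(\<Sum>i\<le>m. u ^ i / v ^ Suc i) + (u / v) ^ Suc m / (v - u) = 1 / (v - u)"
      if "u \<noteq> v" "v \<noteq> 0" for u v :: complex and m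
    proof (induction m)
      case 0 then show ?case using that by (simp add: field_simps)
    next
      case (Suc m)
      have "u ^ Suc m / v ^ Suc (Suc m) + (u / v) ^ Suc (Suc m) / (v - u) = (u / v) ^ Suc m / (v - u)"
        using that by (simp add: field_simps)
      with Suc show ?case by (simp only: sum.atMost_Suc add.assoc)
    qed
    have "((\<lambda>z. f z / (z - w) - (\<Sum>i\<le>m. f z * z powi (- int i - 1) * w ^ i)) has_contour_integral
        I - (\<Sum>i\<le>m. 2 * of_real pi * \<i> * coef (int i) ?O * w ^ i)) ?O"
      by (intro has_contour_integral_diff has_contour_integral_sum has_contour_integral_rmul coef IJ) auto
    then have "cmod (I - (\<Sum>i\<le>m. 2 * of_real pi * \<i> * coef (int i) ?O * w ^ i))
        \<le> (M * (t / \<rho>) ^ Suc m / (\<rho> - t)) * (2 * pi * \<rho>)"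
    proof (rule has_contour_integral_bound_circlepath)
      fix z assume "cmod (z - 0) = \<rho>"
      then have z: "cmod z = \<rho>" by simp
      then have "z \<noteq> w" using w t by auto
      have "f z / (z - w) - (\<Sum>i\<le>m. f z * z powi (- int i - 1) * w ^ i)
          = f z * (1 / (z - w) - (\<Sum>i\<le>m. w ^ i / z ^ Suc i))"
        using onO(2)[OF z]
        by (simp add: right_diff_distrib sum_distrib_left power_int_diff power_int_minus field_simps)
      also have "1 / (z - w) - (\<Sum>i\<le>m. w ^ i / z ^ Suc i) = (w / z) ^ Suc m / (z - w)"
        using geo[of w z m] \<open>z \<noteq> w\<close> onO(2)[OF z] by (simp add: algebra_simps)
      finally have "cmod (f z / (z - w) - (\<Sum>i\<le>m. f z * z powi (- int i - 1) * w ^ i))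
          = cmod (f z) * ((cmod w / \<rho>) ^ Suc m / cmod (z - w))"
        by (simp add: norm_mult norm_divide norm_power z)
      also have "\<dots> \<le> M * ((t / \<rho>) ^ Suc m / (\<rho> - t))"
      proof (intro mult_mono frac_le power_mono divide_right_mono)
        show "\<rho> - t \<le> cmod (z - w)" using norm_triangle_ineq2[of z w] z w by linarith
      qed (use M[OF onO(1)[OF z]] M0 w t \<rho> in auto)
      finally show "cmod (f z / (z - w) - (\<Sum>i\<le>m. f z * z powi (- int i - 1) * w ^ i))
          \<le> M * (t / \<rho>) ^ Suc m / (\<rho> - t)" by simp
    qed (use M0 t \<rho> in auto)
    also have "(\<Sum>i\<le>m. 2 * of_real pi * \<i> * coef (int i) ?O * w ^ i) = 2 * of_real pi * \<i> * P"
      by (simp add: P_def sum_distrib_left mult.assoc)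
    finally have outer: "cmod (I - 2 * of_real pi * \<i> * P) \<le> (M * (t / \<rho>) ^ Suc m / (\<rho> - t)) * (2 * pi * \<rho>)" .
    have "((\<lambda>z. f z / (z - w) + (\<Sum>i\<in>{1..m}. f z * z powi (- (- int i) - 1) * inverse w ^ i)) has_contour_integral
        J + (\<Sum>i\<in>{1..m}. 2 * of_real pi * \<i> * coef (- int i) ?I * inverse w ^ i)) ?I"
      by (intro has_contour_integral_add has_contour_integral_sum has_contour_integral_rmul coef IJ) auto
    then have "cmod (J + (\<Sum>i\<in>{1..m}. 2 * of_real pi * \<i> * coef (- int i) ?I * inverse w ^ i))
        \<le> (M * (t / \<rho>) ^ m / (1 / t - 1 / \<rho>)) * (2 * pi * (1 / \<rho>))"
    proof (rule has_contour_integral_bound_circlepath)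
      fix z assume "cmod (z - 0) = 1 / \<rho>"
      then have z: "cmod z = 1 / \<rho>" by simp
      then have "z \<noteq> w" using w tr by auto
      have powz: "z powi (- (- int (Suc i)) - 1) = z ^ i" for i by simp
      have shift: "(\<Sum>i\<in>{1..m}. f z * z powi (- (- int i) - 1) * inverse w ^ i) = (\<Sum>i<m. f z * z ^ i * inverse w ^ Suc i)"
        by (simp only: One_nat_def sum.atLeast1_atMost_eq powz)
      have gm: "1 / (z - w) + (\<Sum>i<m. z ^ i * inverse w ^ Suc i) = (z / w) ^ m / (z - w)"
      proof (cases m)
        case (Suc m')
        then show ?thesis using geo[of z w m'] \<open>z \<noteq> w\<close> w0 unfolding Suc lessThan_Suc_atMost
          by (simp add: divide_inverse power_inverse minus_diff_eq[of w z, symmetric] del: minus_diff_eq)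
             (simp add: algebra_simps)
      qed simp
      have "f z / (z - w) + (\<Sum>i\<in>{1..m}. f z * z powi (- (- int i) - 1) * inverse w ^ i)
          = f z * (1 / (z - w) + (\<Sum>i<m. z ^ i * inverse w ^ Suc i))"
        unfolding shift by (simp add: distrib_left sum_distrib_left mult.assoc del: power_Suc)
      then have "cmod (f z / (z - w) + (\<Sum>i\<in>{1..m}. f z * z powi (- (- int i) - 1) * inverse w ^ i))
          = cmod (f z) * ((1 / \<rho> / cmod w) ^ m / cmod (z - w))"
        unfolding gm by (simp only: norm_mult norm_divide norm_power z)
      also have "\<dots> \<le> M * ((t / \<rho>) ^ m / (1 / t - 1 / \<rho>))"
      proof -
        have "1 / t - 1 / \<rho> \<le> cmod (z - w)"
          using norm_triangle_ineq2[of w z] z w by (simp add: norm_minus_commute)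
        moreover have "1 / \<rho> / cmod w \<le> 1 / \<rho> / (1 / t)" using w t \<rho> w0 by (intro frac_le) auto
        then have "(1 / \<rho> / cmod w) ^ m \<le> (t / \<rho>) ^ m" using \<rho> by (intro power_mono) auto
        ultimately have "(1 / \<rho> / cmod w) ^ m / cmod (z - w) \<le> (t / \<rho>) ^ m / (1 / t - 1 / \<rho>)"
          using tr t \<rho> by (intro frac_le) auto
        then show ?thesis using M[OF onI(1)[OF z]] M0 \<rho> by (intro mult_mono) auto
      qed
      finally show "cmod (f z / (z - w) + (\<Sum>i\<in>{1..m}. f z * z powi (- (- int i) - 1) * inverse w ^ i))
          \<le> M * (t / \<rho>) ^ m / (1 / t - 1 / \<rho>)" by simp
    qed (use M0 t \<rho> tr in auto)
    also have "(\<Sum>i\<in>{1..m}. 2 * of_real pi * \<i> * coef (- int i) ?I * inverse w ^ i) = 2 * of_real pi * \<i> * N"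
      by (simp add: N_def sum_distrib_left mult.assoc)
    finally have inner: "cmod (J + 2 * of_real pi * \<i> * N) \<le> (M * (t / \<rho>) ^ m / (1 / t - 1 / \<rho>)) * (2 * pi * (1 / \<rho>))" .
    have PN: "(\<Sum>k\<in>{- int m..int m}. a k * w powi k) = P + N"
    proof -
      have "(\<Sum>i\<le>m. a (- int i) * w powi (- int i)) = a 0 + (\<Sum>i\<in>{1..m}. a (- int i) * w powi (- int i))"
        by (simp add: atMost_atLeast0 sum.atLeast_Suc_atMost)
      also have "(\<Sum>i\<in>{1..m}. a (- int i) * w powi (- int i)) = N"
        unfolding N_def by (rule sum.cong) (auto simp: a_def power_int_minus power_inverse)
      finally show ?thesis unfolding sum_symmetric_interval by (simp add: P_def a_def)
    qed
    have "2 * pi * cmod (f w - (P + N)) = cmod (2 * of_real pi * \<i> * (f w - (P + N)))"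
      by (simp add: norm_mult)
    also have "2 * of_real pi * \<i> * (f w - (P + N)) = (I - 2 * of_real pi * \<i> * P) - (J + 2 * of_real pi * \<i> * N)"
      using IJ(3) by (simp add: algebra_simps)
    also have "cmod \<dots> \<le> (M * (t / \<rho>) ^ Suc m / (\<rho> - t)) * (2 * pi * \<rho>) + (M * (t / \<rho>) ^ m / (1 / t - 1 / \<rho>)) * (2 * pi * (1 / \<rho>))"
      by (rule order_trans[OF norm_triangle_ineq4 add_mono[OF outer inner]])
    also have "(M * (t / \<rho>) ^ Suc m / (\<rho> - t)) * (2 * pi * \<rho>) = 2 * pi * (M * (t / \<rho>) ^ m * (t / (\<rho> - t)))"
      using \<rho> by simp
    also have "(M * (t / \<rho>) ^ m / (1 / t - 1 / \<rho>)) * (2 * pi * (1 / \<rho>)) = 2 * pi * (M * (t / \<rho>) ^ m * (1 / ((1 / t - 1 / \<rho>) * \<rho>)))"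
      by simp
    also have "1 / ((1 / t - 1 / \<rho>) * \<rho>) = t / (\<rho> - t)"
      using t \<rho> by (simp add: field_simps)
    also have "2 * pi * (M * (t / \<rho>) ^ m * (t / (\<rho> - t))) + 2 * pi * (M * (t / \<rho>) ^ m * (t / (\<rho> - t)))
        = 2 * pi * (2 * (M * (t / \<rho>) ^ m * (t / (\<rho> - t))))" by simp
    also have "\<dots> \<le> 2 * pi * (2 * (M * (t / \<rho>) ^ m * (\<rho> / (\<rho> - t))))"
      using M0 t by (intro mult_left_mono divide_right_mono) auto
    finally have "cmod (f w - (P + N)) \<le> 2 * (M * (t / \<rho>) ^ m * (\<rho> / (\<rho> - t)))"
      by (rule mult_left_le_imp_le) simp
    then show "cmod (f w - (\<Sum>k\<in>{- int m..int m}. a k * w powi k)) \<le> 2 * M * (t / \<rho>) ^ m * \<rho> / (\<rho> - t)"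
      unfolding PN by (simp add: mult.assoc)
  qed
qed

lemma norm_power_int_le:
  assumes "1 \<le> r" "1 / r \<le> cmod w" "cmod w \<le> r" "\<bar>k\<bar> \<le> int m"
  shows "cmod (w powi k) \<le> r ^ m"
proof (cases "0 \<le> k")
  case True
  have "cmod (w powi k) = cmod w ^ nat k" using True by (simp add: power_int_def norm_power)
  also have "\<dots> \<le> r ^ nat k" using assms by (intro power_mono) auto
  also have "\<dots> \<le> r ^ m" using assms by (intro power_increasing) auto
  finally show ?thesis .
next
  case False
  have "inverse (cmod w) \<le> inverse (1 / r)" using assms by (intro le_imp_inverse_le) auto
  then have *: "inverse (cmod w) \<le> r" by simp
  have "cmod (w powi k) = inverse (cmod w) ^ nat (- k)" using False by (simp add: power_int_def norm_power norm_inverse)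
  also have "\<dots> \<le> r ^ nat (- k)" using * by (intro power_mono) auto
  also have "\<dots> \<le> r ^ m" using assms by (intro power_increasing) auto
  finally show ?thesis .
qed

text \<open>The truncated Laurent series of \<open>f\<close> with its coefficients replaced by averages over roots of
  unity. Unlike the true Laurent coefficients, these involve only finitely many values of \<open>f\<close>, so no
  question of regularity in further parameters arises when \<open>f\<close> depends on other variables.\<close>

definition node_approx :: "nat \<Rightarrow> (complex \<Rightarrow> complex) \<Rightarrow> complex \<Rightarrow> complex" where
  "node_approx m f w = (\<Sum>l<2*m+1. \<Sum>k\<in>{- int m..int m}.
     f (unity (2*m+1) l) * (unity (2*m+1) l powi (- k) / of_nat (2*m+1) * w powi k))"

lemma node_approx_Laurent_polynomial:
  "node_approx m (\<lambda>z. \<Sum>k\<in>{- int m..int m}. a k * z powi k) w = (\<Sum>k\<in>{- int m..int m}. a k * w powi k)"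
proof -
  let ?L = "2 * m + 1"
  have swap: "(\<Sum>l\<in>A. \<Sum>k\<in>B. F l * (U l k / c * W k)) = (\<Sum>k\<in>B. (\<Sum>l\<in>A. U l k * F l) * W k / c)"
    for A :: "nat set" and B :: "int set" and F U W and c :: complex
    by (subst sum.swap) (simp add: sum_distrib_left sum_distrib_right sum_divide_distrib mult_ac)
  have "node_approx m (\<lambda>z. \<Sum>k\<in>{- int m..int m}. a k * z powi k) w
      = (\<Sum>k\<in>{- int m..int m}. (\<Sum>l<?L. unity ?L l powi (- k) * (\<Sum>k'\<in>{- int m..int m}. unity ?L l powi k' * a k')) * w powi k / of_nat ?L)"
    unfolding node_approx_def by (simp only: swap mult.commute[of "a _"])
  also have "\<dots> = (\<Sum>k\<in>{- int m..int m}. a k * w powi k)"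
  proof (rule sum.cong[OF refl])
    fix k assume k: "k \<in> {- int m..int m}"
    have "(\<Sum>l<?L. unity ?L l powi (- k) * (\<Sum>k'\<in>{- int m..int m}. unity ?L l powi k' * a k')) = of_nat ?L * a k"
      using unity_extracts_coefficient[of "- k" m m ?L a] k by auto
    then show "(\<Sum>l<?L. unity ?L l powi (- k) * (\<Sum>k'\<in>{- int m..int m}. unity ?L l powi k' * a k')) * w powi k / of_nat ?L = a k * w powi k"
      by (simp del: of_nat_add of_nat_mult of_nat_Suc sum.lessThan_Suc)
  qed
  finally show ?thesis .
qed

lemma node_approx_bound:
  assumes f: "\<And>l. cmod (f (unity (2*m+1) l)) \<le> E" and r: "1 \<le> r" "1 / r \<le> cmod w" "cmod w \<le> r"
  shows "cmod (node_approx m f w) \<le> E * ((2 * real m + 1) * r ^ m)"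
proof -
  let ?L = "2 * m + 1"
  have E0: "0 \<le> E" using f norm_ge_zero order_trans by blast
  have "cmod (node_approx m f w) \<le> (\<Sum>l<?L. \<Sum>k\<in>{- int m..int m}. E * (1 / real ?L * r ^ m))"
    unfolding node_approx_def
  proof (intro sum_norm_le)
    fix l k assume "k \<in> {- int m..int m}"
    then have "cmod (w powi k) \<le> r ^ m" by (intro norm_power_int_le r) auto
    moreover have "cmod (unity ?L l powi (- k) / of_nat ?L) = 1 / real ?L"
      by (simp only: norm_divide norm_power_int norm_unity norm_of_nat power_int_1_left)
    ultimately show "cmod (f (unity ?L l) * (unity ?L l powi (- k) / of_nat ?L * w powi k)) \<le> E * (1 / real ?L * r ^ m)"
      unfolding norm_mult by (intro mult_mono f) (use E0 in auto)
  qed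
  also have "\<dots> = E * ((2 * real m + 1) * r ^ m)"
  proof -
    have "card {- int m..int m} = 2 * m + 1" by simp
    then show ?thesis by (simp add: field_simps)
  qed
  finally show ?thesis .
qed

text \<open>The operator \<open>node_approx m\<close> reproduces Laurent polynomials of degree \<open>m\<close> and its norm, from the unit
  circle to the annulus, grows at most like \<open>m r\<^sup>m\<close>. On the unit circle the truncation error is of order \<open>\<rho>\<^sup>-\<^sup>m\<close>
  with \<open>\<rho> > r\<close>, so the product still tends to \<open>0\<close>, uniformly over all \<open>f\<close> bounded by \<open>M\<close>.\<close>

lemma node_approx_converges:
  assumes r: "1 \<le> r" "r < R" and eps: "\<epsilon> > 0" and M0: "0 \<le> M"
  obtains m where "\<And>f w. f holomorphic_on annulus R \<Longrightarrow> (\<And>z. z \<in> annulus R \<Longrightarrow> cmod (f z) \<le> M) \<Longrightarrow>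
     1 / r \<le> cmod w \<Longrightarrow> cmod w \<le> r \<Longrightarrow> cmod (f w - node_approx m f w) \<le> \<epsilon>"
proof -
  obtain \<rho> where \<rho>: "r < \<rho>" "\<rho> < R" using dense r(2) by blast
  define q where "q = r / \<rho>"
  have q: "0 < q" "q < 1" using r \<rho> by (auto simp: q_def)
  define B where "B = 2 * M * \<rho> / (\<rho> - r)"
  have "(\<lambda>m. q ^ m) \<longlonglongrightarrow> 0" by (rule LIMSEQ_realpow_zero) (use q in auto)
  moreover have "(\<lambda>m. real m * q ^ m) \<longlonglongrightarrow> 0" by (rule powser_times_n_limit_0) (use q in auto)
  ultimately have tend: "(\<lambda>m. B * (2 * (q ^ m + real m * q ^ m))) \<longlonglongrightarrow> B * (2 * (0 + 0))"
    by (intro tendsto_mult tendsto_const tendsto_add)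
  have "B * (2 * (0 + 0)) < \<epsilon>" using eps by simp
  from order_tendstoD(2)[OF tend this]
  have "\<forall>\<^sub>F m in sequentially. B * (2 * (q ^ m + real m * q ^ m)) < \<epsilon>" .
  then obtain m where m: "B * (2 * (q ^ m + real m * q ^ m)) < \<epsilon>"
    using eventually_happens'[OF sequentially_bot] by blast
  show thesis
  proof (rule that[of m])
    fix f w
    assume f: "f holomorphic_on annulus R" "\<And>z. z \<in> annulus R \<Longrightarrow> cmod (f z) \<le> M"
      and w: "1 / r \<le> cmod w" "cmod w \<le> r"
    have \<rho>1: "1 < \<rho>" using r \<rho> by simp
    obtain a where a: "\<And>t w. 1 \<le> t \<Longrightarrow> t < \<rho> \<Longrightarrow> 1 / t \<le> cmod w \<Longrightarrow> cmod w \<le> t \<Longrightarrow>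
      cmod (f w - (\<Sum>k\<in>{- int m..int m}. a k * w powi k)) \<le> 2 * M * (t / \<rho>) ^ m * \<rho> / (\<rho> - t)"
      by (rule annulus_Laurent_truncation[OF f(1) \<rho>1 \<rho>(2) f(2), where m=m], assumption, rule that)
    define p where "p = (\<lambda>w. \<Sum>k\<in>{- int m..int m}. a k * w powi k)"
    have e1: "cmod (f w - p w) \<le> B * q ^ m"
      using a[of r w] r \<rho> w by (simp add: p_def B_def q_def mult_ac)
    have "cmod (node_approx m (\<lambda>z. f z - p z) w) \<le> (B * (1 / \<rho>) ^ m) * ((2 * real m + 1) * r ^ m)"
    proof (rule node_approx_bound)
      fix l
      have "cmod (f (unity (2*m+1) l) - p (unity (2*m+1) l)) \<le> 2 * M * (1 / \<rho>) ^ m * \<rho> / (\<rho> - 1)"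
        unfolding p_def by (rule a) (use r \<rho> in auto)
      also have "\<dots> = 2 * M * (1 / \<rho>) ^ m * (\<rho> / (\<rho> - 1))" by (rule times_divide_eq_right[symmetric])
      also have "\<dots> \<le> 2 * M * (1 / \<rho>) ^ m * (\<rho> / (\<rho> - r))"
        using r \<rho> M0 by (intro mult_left_mono frac_le) auto
      finally show "cmod (f (unity (2*m+1) l) - p (unity (2*m+1) l)) \<le> B * (1 / \<rho>) ^ m"
        by (simp add: B_def mult_ac)
    qed (use r w in auto)
    also have "\<dots> = B * ((2 * real m + 1) * q ^ m)"
      by (simp add: q_def power_divide)
    finally have e2: "cmod (node_approx m (\<lambda>z. f z - p z) w) \<le> B * ((2 * real m + 1) * q ^ m)" .
    have "node_approx m (\<lambda>z. f z - p z) w = node_approx m f w - node_approx m p w"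
      by (simp only: node_approx_def left_diff_distrib sum_subtractf)
    also have "node_approx m p w = p w"
      unfolding p_def by (rule node_approx_Laurent_polynomial)
    finally have eq: "f w - node_approx m f w = (f w - p w) - node_approx m (\<lambda>z. f z - p z) w" by simp
    have "cmod (f w - node_approx m f w) \<le> B * q ^ m + B * ((2 * real m + 1) * q ^ m)"
      unfolding eq by (rule order_trans[OF norm_triangle_ineq4 add_mono[OF e1 e2]])
    also have "\<dots> = B * (2 * (q ^ m + real m * q ^ m))" by (simp add: algebra_simps)
    finally show "cmod (f w - node_approx m f w) \<le> \<epsilon>" using m by simp
  qed
qed

text \<open>The first condition says that only the first \<open>n\<close> coordinates matter; functions on \<open>nat \<Rightarrow> complex\<close> in this
  sense serve as functions of \<open>n\<close> variables, for every \<open>n\<close> at once.\<close>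

definition bounded_sep_holomorphic :: "nat \<Rightarrow> real \<Rightarrow> real \<Rightarrow> ((nat \<Rightarrow> complex) \<Rightarrow> complex) \<Rightarrow> bool" where
  "bounded_sep_holomorphic n R M f \<longleftrightarrow>
    (\<forall>z w. (\<forall>j<n. z j = w j) \<longrightarrow> f z = f w) \<and>
    (\<forall>z. (\<forall>j<n. z j \<in> annulus R) \<longrightarrow> cmod (f z) \<le> M \<and> (\<forall>j<n. (\<lambda>t. f (z(j := t))) holomorphic_on annulus R))"

lemma unity_in_annulus: "1 < R \<Longrightarrow> unity L l \<in> annulus R"
  by (simp add: annulus_def inverse_less_1_iff)

text \<open>Induction on \<open>n\<close>: in the last variable \<open>f\<close> is approximated by \<open>node_approx\<close>, and each of the finitely
  many slices \<open>f (z(n := \<omega> l))\<close> that occur there is approximated by the induction hypothesis. The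
  tolerance \<open>\<epsilon>'\<close> compensates the norm of \<open>node_approx\<close>.\<close>

lemma Laurent_approximation:
  fixes T :: "nat \<Rightarrow> 'a::complex_hilbert \<Rightarrow> 'a"
  assumes "bounded_sep_holomorphic n R M f" and r: "1 \<le> r" "r < R" and M: "0 \<le> M" and tup: "annulus_tuple r' n T" and "\<epsilon> > 0"
  shows "\<exists>h S. Laurent_calc n T h S \<and> (\<forall>z\<in>polyannulus n r. cmod (f z - h z) \<le> \<epsilon>)"
  using assms(1,5,6)
proof (induction n arbitrary: f \<epsilon>)
  case 0
  then have "f z = f (\<lambda>_. 0)" for z unfolding bounded_sep_holomorphic_def by blast
  then have "cmod (f z - f (\<lambda>_. 0)) \<le> \<epsilon>" for z using 0(3) by (metis cancel_comm_monoid_add_class.diff_cancel norm_zero less_imp_le)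
  then show ?case using Laurent_calc.const[of 0 T "f (\<lambda>_. 0)"] by blast
next
  case (Suc n)
  note tup = Suc.prems(2) and tup' = annulus_tuple_Suc[OF Suc.prems(2)]
  have local: "f z = f w" if "\<And>j. j < Suc n \<Longrightarrow> z j = w j" for z w
    using Suc.prems(1) that unfolding bounded_sep_holomorphic_def by blast
  have bound: "cmod (f z) \<le> M" and hol: "j < Suc n \<Longrightarrow> (\<lambda>t. f (z(j := t))) holomorphic_on annulus R"
    if "\<And>j. j < Suc n \<Longrightarrow> z j \<in> annulus R" for z j
    using Suc.prems(1) that unfolding bounded_sep_holomorphic_def by blast+
  have "\<epsilon> / 2 > 0" using Suc.prems(3) by simp
  from node_approx_converges[OF r this M] obtain m where m:
    "\<And>f w. f holomorphic_on annulus R \<Longrightarrow> (\<And>z. z \<in> annulus R \<Longrightarrow> cmod (f z) \<le> M) \<Longrightarrow>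
     1 / r \<le> cmod w \<Longrightarrow> cmod w \<le> r \<Longrightarrow> cmod (f w - node_approx m f w) \<le> \<epsilon> / 2"
    by blast
  define L where "L = 2 * m + 1"
  define \<omega> where "\<omega> = unity L"
  have R1: "1 < R" using r by simp
  have \<omega>: "\<omega> l \<in> annulus R" for l using unity_in_annulus[OF R1] by (simp add: \<omega>_def)
  define \<epsilon>' where "\<epsilon>' = \<epsilon> / (2 * ((2 * real m + 1) * r ^ m))"
  have den: "0 < (2 * real m + 1) * r ^ m" using r by simp
  then have eps': "\<epsilon>' > 0" using Suc.prems(3) by (simp add: \<epsilon>'_def)
  have slice: "bounded_sep_holomorphic n R M (\<lambda>z. f (z(n := \<omega> l)))" for l
    unfolding bounded_sep_holomorphic_def
  proof (intro conjI allI impI)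
    fix z w :: "nat \<Rightarrow> complex" assume "\<forall>j<n. z j = w j"
    then show "f (z(n := \<omega> l)) = f (w(n := \<omega> l))" by (intro local) (auto simp: less_Suc_eq)
  next
    fix z :: "nat \<Rightarrow> complex" assume z: "\<forall>j<n. z j \<in> annulus R"
    then show "cmod (f (z(n := \<omega> l))) \<le> M" using \<omega> by (intro bound) (auto simp: less_Suc_eq)
    fix j assume j: "j < n"
    have "(\<lambda>t. f ((z(n := \<omega> l))(j := t))) holomorphic_on annulus R"
      using z \<omega> j by (intro hol) (auto simp: less_Suc_eq)
    then show "(\<lambda>t. f ((z(j := t))(n := \<omega> l))) holomorphic_on annulus R"
      using j by (simp add: fun_upd_twist)
  qed
  have "\<forall>l. \<exists>h S. Laurent_calc n T h S \<and>
    (\<forall>z\<in>polyannulus n r. cmod (f (z(n := \<omega> l)) - h z) \<le> \<epsilon>')"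
    using Suc.IH[OF slice tup' eps'] by blast
  then obtain h S where hS: "\<And>l. Laurent_calc n T (h l) (S l)"
    "\<And>l z. z \<in> polyannulus n r \<Longrightarrow> cmod (f (z(n := \<omega> l)) - h l z) \<le> \<epsilon>'"
    by metis
  define c where "c = (\<lambda>l k. \<omega> l powi (- k) / of_nat L)"
  define H where "H = (\<lambda>z. \<Sum>l<L. \<Sum>k\<in>{- int m..int m}. c l k * (z n powi k * h l z))"
  have regroup: "(\<Sum>l\<in>A. \<Sum>k\<in>B. (F l - G l) * (C l k * Z k))
      = (\<Sum>l\<in>A. \<Sum>k\<in>B. F l * (C l k * Z k)) - (\<Sum>l\<in>A. \<Sum>k\<in>B. C l k * (Z k * G l))"
    for A :: "nat set" and B :: "int set" and F G C and Z :: "int \<Rightarrow> complex"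
    by (simp add: algebra_simps sum_subtractf)
  have calc: "Laurent_calc (Suc n) T H (\<lambda>x. \<Sum>l<L. \<Sum>k\<in>{- int m..int m}. c l k *\<^sub>C opow (T n) k (S l x))"
    unfolding H_def
    by (intro Laurent_calc_sum Laurent_calc_scale[OF _ tup] Laurent_calc_power[OF _ _ tup] Laurent_calc_mono[OF hS(1)]) auto
  have "cmod (f z - H z) \<le> \<epsilon>" if "z \<in> polyannulus (Suc n) r" for z
  proof -
    have z: "\<forall>j<Suc n. 1 / r \<le> cmod (z j) \<and> cmod (z j) \<le> r" using that by (simp add: polyannulus_def)
    have zn: "1 / r \<le> cmod (z n)" "cmod (z n) \<le> r" using z by auto
    have inv: "inverse R < 1 / r" using r by (simp add: inverse_eq_divide frac_less2)
    have zR: "z j \<in> annulus R" if "j < Suc n" for j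
    proof -
      have "1 / r \<le> cmod (z j)" "cmod (z j) \<le> r" using z that by auto
      then have "inverse R < cmod (z j)" "cmod (z j) < R" using inv r by linarith+
      then show ?thesis by (simp add: annulus_def)
    qed
    have e1: "cmod (f (z(n := z n)) - node_approx m (\<lambda>t. f (z(n := t))) (z n)) \<le> \<epsilon> / 2"
    proof (rule m)
      show "(\<lambda>t. f (z(n := t))) holomorphic_on annulus R" by (rule hol[OF zR]) auto
      show "cmod (f (z(n := t))) \<le> M" if "t \<in> annulus R" for t
        by (rule bound) (use zR that in auto)
    qed (use zn in auto)
    have "cmod (\<Sum>l<L. \<Sum>k\<in>{- int m..int m}. (f (z(n := \<omega> l)) - h l z) * (c l k * z n powi k))
        \<le> (\<Sum>l<L. \<Sum>k\<in>{- int m..int m}. \<epsilon>' * (1 / real L * r ^ m))"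
    proof (intro sum_norm_le)
      fix l k assume "k \<in> {- int m..int m}"
      then have "cmod (z n powi k) \<le> r ^ m" using zn r by (intro norm_power_int_le) auto
      moreover have "cmod (c l k) = 1 / real L"
        by (simp only: c_def \<omega>_def norm_divide norm_power_int norm_unity norm_of_nat power_int_1_left)
      moreover have "cmod (f (z(n := \<omega> l)) - h l z) \<le> \<epsilon>'" using z by (intro hS(2)) (auto simp: polyannulus_def)
      ultimately show "cmod ((f (z(n := \<omega> l)) - h l z) * (c l k * z n powi k)) \<le> \<epsilon>' * (1 / real L * r ^ m)"
        unfolding norm_mult using eps' by (intro mult_mono) auto
    qed
    also have "\<dots> = \<epsilon>' * ((2 * real m + 1) * r ^ m)"
      by (simp add: L_def field_simps)
    also have "\<dots> = \<epsilon> / 2" using den r by (simp add: \<epsilon>'_def)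
    also have "(\<Sum>l<L. \<Sum>k\<in>{- int m..int m}. (f (z(n := \<omega> l)) - h l z) * (c l k * z n powi k))
        = node_approx m (\<lambda>t. f (z(n := t))) (z n) - H z"
      unfolding node_approx_def H_def c_def \<omega>_def L_def by (rule regroup)
    finally show ?thesis
      using norm_triangle_le[of "f z - node_approx m (\<lambda>t. f (z(n := t))) (z n)" "node_approx m (\<lambda>t. f (z(n := t))) (z n) - H z" \<epsilon>] e1
      by simp
  qed
  with calc show ?case by blast
qed

section \<open>Polynomials without zeros on the polyannulus\<close>

text \<open>A boundary point is reached by scaling it slightly towards the unit circle.\<close>

lemma closure_annulus:
  assumes r: "r > 1"
  shows "closure (annulus r) = {z. 1 / r \<le> cmod z \<and> cmod z \<le> r}"
proof (rule antisym)
  have "{z. 1 / r \<le> cmod z \<and> cmod z \<le> r} = {z. 1 / r \<le> cmod z} \<inter> {z. cmod z \<le> r}" by auto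
  then have "closed {z. 1 / r \<le> cmod z \<and> cmod z \<le> r}"
    by (simp add: closed_Int closed_Collect_le continuous_on_norm_id)
  then show "closure (annulus r) \<subseteq> {z. 1 / r \<le> cmod z \<and> cmod z \<le> r}"
    by (intro closure_minimal) (auto simp: annulus_def inverse_eq_divide)
  show "{z. 1 / r \<le> cmod z \<and> cmod z \<le> r} \<subseteq> closure (annulus r)"
  proof
    fix z assume "z \<in> {z. 1 / r \<le> cmod z \<and> cmod z \<le> r}"
    moreover define i where "i = 1 / r"
    ultimately have z: "i \<le> cmod z" "cmod z \<le> r" by auto
    have i: "0 < i" "i < 1" "inverse r = i" using r by (auto simp: i_def inverse_eq_divide)
    have ri: "1 - i \<le> r - 1"
    proof -
      have "1 - i = (r - 1) * i" using r by (simp add: i_def field_simps)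
      also have "\<dots> \<le> (r - 1) * 1" using r i by (intro mult_left_mono) auto
      finally show ?thesis by simp
    qed
    have pos: "0 < cmod z" using z(1) i by linarith
    show "z \<in> closure (annulus r)"
      unfolding closure_approachable
    proof (intro allI impI)
      fix e :: real assume e: "0 < e"
      obtain s where s: "0 < s" "s < 1 - i" "s < e / r"
      proof -
        have "0 < min (1 - i) (e / r)" using e r i by simp
        then obtain s where "0 < s" "s < min (1 - i) (e / r)" using dense by blast
        then show thesis using that by simp
      qed
      have "s * cmod z \<le> s * r" using s z by (intro mult_left_mono) auto
      also have "\<dots> < e" using s(3) r by (simp add: pos_less_divide_eq)
      finally have small: "s * cmod z < e" .
      define c where "c = (if 1 \<le> cmod z then 1 - s else 1 + s)"
      have c: "0 < c" "\<bar>c - 1\<bar> = s" using s i by (auto simp: c_def)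
      define y where "y = of_real c * z"
      have ny: "cmod y = c * cmod z" using c by (simp add: y_def norm_mult)
      have "y - z = of_real (c - 1) * z" by (simp add: y_def algebra_simps)
      then have "dist y z = s * cmod z" using c(2) by (simp only: dist_norm norm_mult norm_of_real)
      moreover have "i < cmod y \<and> cmod y < r"
      proof (cases "1 \<le> cmod z")
        case True
        have "(1 - s) * 1 \<le> (1 - s) * cmod z" using True s i by (intro mult_left_mono) auto
        moreover have "(1 - s) * cmod z < 1 * cmod z" using s pos by (intro mult_strict_right_mono) auto
        ultimately show ?thesis using True s z ny by (simp add: c_def)
      next
        case False
        have "1 * cmod z < (1 + s) * cmod z" using s pos by (intro mult_strict_right_mono) auto
        moreover have "(1 + s) * cmod z < 1 + s"
          using False s mult_strict_left_mono[of "cmod z" 1 "1 + s"] by simp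
        ultimately have "i < (1 + s) * cmod z" "(1 + s) * cmod z < r" using s z ri by linarith+
        then show ?thesis using False ny by (simp add: c_def)
      qed
      ultimately show "\<exists>y\<in>annulus r. dist y z < e"
        using small i by (intro bexI[of _ y]) (simp_all add: annulus_def)
    qed
  qed
qed

text \<open>The coordinates beyond \<open>n\<close>, which are free in \<open>polyannulus\<close>, are fixed to \<open>0\<close> in order to obtain a
  compact set in the product topology.\<close>

definition zero_extended_polyannulus :: "nat \<Rightarrow> real \<Rightarrow> (nat \<Rightarrow> complex) set" where
  "zero_extended_polyannulus n r = {z. \<forall>j. if j < n then 1 / r \<le> cmod (z j) \<and> cmod (z j) \<le> r else z j = 0}"

lemma compact_zero_extended_polyannulus: "compact (zero_extended_polyannulus n r)"
proof -
  define A where "A = (\<lambda>j. if j < n then {z. 1 / r \<le> cmod z \<and> cmod z \<le> r} else {0::complex})"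
  have "compact (A j)" for j
  proof (cases "j < n")
    case True
    have "{z. 1 / r \<le> cmod z \<and> cmod z \<le> r} = {z. 1 / r \<le> cmod z} \<inter> cball 0 r" by auto
    then have "compact {z. 1 / r \<le> cmod z \<and> cmod z \<le> r}"
      by (simp add: closed_Int_compact closed_Collect_le continuous_on_norm_id)
    then show ?thesis using True by (simp add: A_def)
  qed (simp add: A_def)
  then have "compactin (product_topology (\<lambda>i. euclidean) UNIV) (PiE UNIV A)"
    by (subst compactin_PiE) (simp add: compactin_euclidean_iff)
  moreover have "PiE UNIV A = zero_extended_polyannulus n r"
    by (auto simp: zero_extended_polyannulus_def A_def PiE_iff split: if_splits)
  ultimately show ?thesis by (simp add: euclidean_product_topology)
qed

lemma continuous_on_poly_eval: "continuous_on X (poly_eval n p)"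
proof -
  have "continuous_on X (\<lambda>z::nat \<Rightarrow> complex. z j)" for j
    by (rule continuous_on_subset[OF continuous_on_product_coordinates]) simp
  then have "continuous_on X (\<lambda>z. poly_eval n p z)"
    unfolding poly_eval_def by (intro continuous_intros)
  then show ?thesis by simp
qed

lemma poly_eval_local: "(\<And>j. j < n \<Longrightarrow> z j = w j) \<Longrightarrow> poly_eval n p z = poly_eval n p w"
  unfolding poly_eval_def by (intro sum.cong prod.cong refl arg_cong2[where f="(*)"]) auto

lemma zero_extended_polyannulus_nonempty: "1 \<le> r \<Longrightarrow> (\<lambda>j. if j < n then 1 else 0) \<in> zero_extended_polyannulus n r"
  by (simp add: zero_extended_polyannulus_def)

lemma zero_extended_polyannulus_restrict:
  assumes "z \<in> polyannulus n r"
  shows "(\<lambda>j. if j < n then z j else 0) \<in> zero_extended_polyannulus n r"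
    and "poly_eval n p (\<lambda>j. if j < n then z j else 0) = poly_eval n p z"
  using assms by (auto simp: zero_extended_polyannulus_def polyannulus_def intro: poly_eval_local)

lemma poly_eval_bounded_on_polyannulus:
  obtains B where "\<And>z. z \<in> polyannulus n r \<Longrightarrow> cmod (poly_eval n p z) \<le> B" "0 \<le> B"
proof -
  have "compact (poly_eval n p ` zero_extended_polyannulus n r)"
    by (intro compact_continuous_image continuous_on_poly_eval compact_zero_extended_polyannulus)
  then obtain B where B: "\<And>z. z \<in> zero_extended_polyannulus n r \<Longrightarrow> cmod (poly_eval n p z) \<le> B"
    using compact_imp_bounded bounded_iff by (metis imageI)
  show thesis
  proof (rule that[of "max B 0"])
    fix z assume z: "z \<in> polyannulus n r"
    show "cmod (poly_eval n p z) \<le> max B 0"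
      using B[OF zero_extended_polyannulus_restrict(1)[OF z]] zero_extended_polyannulus_restrict(2)[OF z, of p] by simp
  qed simp
qed

text \<open>If \<open>q\<close> had zeros on every larger polyannulus, the compact zero sets there would be nested and nonempty, and a point
  of their intersection would be a zero on the polyannulus of radius \<open>r\<close> itself.\<close>

lemma nonvanishing_polynomial_lower_bound:
  assumes r: "1 < r" and nz: "\<And>z. z \<in> zero_extended_polyannulus n r \<Longrightarrow> poly_eval n q z \<noteq> 0"
  obtains R \<delta> where "r < R" "0 < \<delta>"
    "\<And>z. z \<in> polyannulus n R \<Longrightarrow> \<delta> \<le> cmod (poly_eval n q z)"
proof -
  define R where "R = (\<lambda>k. r + 1 / real (Suc k))"
  have R: "r < R k" for k by (simp add: R_def)
  have mono: "zero_extended_polyannulus n s \<subseteq> zero_extended_polyannulus n t" if "0 < s" "s \<le> t" for s t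
  proof -
    have "1 / t \<le> 1 / s" using that by (simp add: frac_le)
    then show ?thesis using that unfolding zero_extended_polyannulus_def by (auto split: if_splits intro: order_trans)
  qed
  have R_anti: "R l \<le> R k" if "k \<le> l" for k l using that by (simp add: R_def frac_le)
  have "\<exists>k. \<forall>z\<in>zero_extended_polyannulus n (R k). poly_eval n q z \<noteq> 0"
  proof (rule ccontr)
    assume "\<not> ?thesis"
    then have zeros: "\<And>k. \<exists>z\<in>zero_extended_polyannulus n (R k). poly_eval n q z = 0" by blast
    define Z where "Z = (\<lambda>k. zero_extended_polyannulus n (R k) \<inter> poly_eval n q -` {0})"
    have closedZ: "closed (Z k)" for k
      unfolding Z_def by (rule continuous_closed_preimage)
        (auto intro: continuous_on_poly_eval compact_imp_closed[OF compact_zero_extended_polyannulus])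
    have fip: "zero_extended_polyannulus n (R 0) \<inter> (\<Inter>k\<in>I. Z k) \<noteq> {}" if fin: "finite I" for I
    proof -
      obtain l where l: "\<forall>k\<in>I. k \<le> l" using fin unfolding finite_nat_set_iff_bounded_le by blast
      obtain z where z: "z \<in> zero_extended_polyannulus n (R l)" "poly_eval n q z = 0" using zeros by blast
      have "z \<in> zero_extended_polyannulus n (R k)" if "k \<le> l" for k
        using z(1) mono[of "R l" "R k"] R_anti[OF that] R[of l] r by auto
      then show ?thesis using z(2) l unfolding Z_def by blast
    qed
    have "zero_extended_polyannulus n (R 0) \<inter> (\<Inter>k\<in>UNIV. Z k) \<noteq> {}"
      by (rule compact_imp_fip_image[OF compact_zero_extended_polyannulus closedZ fip])
    then obtain z where z: "\<And>k. z \<in> zero_extended_polyannulus n (R k)" "poly_eval n q z = 0"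
      unfolding Z_def by blast
    have lim: "R \<longlonglongrightarrow> r"
    proof -
      have "(\<lambda>k. r + 1 / real (Suc k)) \<longlonglongrightarrow> r + 0"
        by (intro tendsto_intros LIMSEQ_Suc[OF lim_const_over_n])
      then show ?thesis by (simp add: R_def)
    qed
    have "z \<in> zero_extended_polyannulus n r"
      unfolding zero_extended_polyannulus_def
    proof (intro CollectI allI)
      fix j
      show "if j < n then 1 / r \<le> cmod (z j) \<and> cmod (z j) \<le> r else z j = 0"
      proof (cases "j < n")
        case True
        have b: "1 / R k \<le> cmod (z j)" "cmod (z j) \<le> R k" for k
          using z(1)[of k] True unfolding zero_extended_polyannulus_def by (auto split: if_splits)
        have "(\<lambda>k. 1 / R k) \<longlonglongrightarrow> 1 / r" using lim r by (intro tendsto_intros) auto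
        then have "1 / r \<le> cmod (z j)" by (rule LIMSEQ_le_const2) (use b in auto)
        moreover have "cmod (z j) \<le> r" using lim by (rule LIMSEQ_le_const) (use b in auto)
        ultimately show ?thesis using True by simp
      next
        case False
        then show ?thesis using z(1)[of 0] unfolding zero_extended_polyannulus_def by (auto split: if_splits)
      qed
    qed
    with nz z(2) show False by blast
  qed
  then obtain k where k: "\<And>z. z \<in> zero_extended_polyannulus n (R k) \<Longrightarrow> poly_eval n q z \<noteq> 0" by blast
  have cont: "continuous_on (zero_extended_polyannulus n (R k)) (\<lambda>z. cmod (poly_eval n q z))"
    by (intro continuous_on_norm continuous_on_poly_eval)
  have "zero_extended_polyannulus n (R k) \<noteq> {}" using zero_extended_polyannulus_nonempty[of "R k" n] R[of k] r by auto
  from continuous_attains_inf[OF compact_zero_extended_polyannulus this cont] obtain z0 where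
    z0: "z0 \<in> zero_extended_polyannulus n (R k)" "\<And>z. z \<in> zero_extended_polyannulus n (R k) \<Longrightarrow> cmod (poly_eval n q z0) \<le> cmod (poly_eval n q z)"
    by blast
  show thesis
  proof (rule that[of "R k" "cmod (poly_eval n q z0)"])
    show "r < R k" by (rule R)
    show "0 < cmod (poly_eval n q z0)" using k[OF z0(1)] by simp
    fix z assume z: "z \<in> polyannulus n (R k)"
    show "cmod (poly_eval n q z0) \<le> cmod (poly_eval n q z)"
      using z0(2)[OF zero_extended_polyannulus_restrict(1)[OF z]] zero_extended_polyannulus_restrict(2)[OF z, of q] by simp
  qed
qed

section \<open>Rational functions of the tuple\<close>

lemma Laurent_calc_monom_op:
  assumes tup: "annulus_tuple r n T" and "k \<le> n"
  shows "Laurent_calc n T (\<lambda>z. \<Prod>j<k. z j ^ Poly_Mapping.lookup m j) (monom_op k m T)"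
  using assms(2)
proof (induction k)
  case 0
  show ?case by (rule Laurent_calc_cong[OF Laurent_calc.const[of n T 1]]) auto
next
  case (Suc k)
  have "Laurent_calc n T (\<lambda>z. z k powi int (Poly_Mapping.lookup m k) * 1) (\<lambda>x. opow (T k) (int (Poly_Mapping.lookup m k)) (1 *\<^sub>C x))"
    by (rule Laurent_calc_power[OF Laurent_calc.const _ tup]) (use Suc in auto)
  from Laurent_calc_mult[OF Suc.IH this tup] Suc.prems show ?case
    by (simp add: opow_def comp_def)
qed

lemma Laurent_calc_poly_op:
  assumes tup: "annulus_tuple r n T"
  shows "Laurent_calc n T (poly_eval n p) (poly_op n p T)"
proof -
  have "Laurent_calc n T (\<lambda>z. poly_eval n p z) (\<lambda>x. poly_op n p T x)"
    unfolding poly_eval_def poly_op_def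
    by (intro Laurent_calc_sum Laurent_calc_scale[OF _ tup] Laurent_calc_monom_op[OF tup]) simp
  then show ?thesis by simp
qed

lemma Laurent_calc_ops_commute:
  assumes f: "Laurent_calc n T f S" and g: "Laurent_calc n T g U" and tup: "annulus_tuple r n T"
  shows "S (U x) = U (S x)"
proof (rule Laurent_calc_commute[OF f Laurent_calc_bounded_clinear[OF g tup]])
  fix j x assume j: "j < n"
  show "T j (U x) = U (T j x)"
    by (rule Laurent_calc_commute[OF g annulus_tupleD(1)[OF tup j], symmetric])
      (use annulus_tuple_commute[OF tup _ j] in auto)
  show "inv (T j) (U x) = U (inv (T j) x)"
    by (rule Laurent_calc_commute[OF g annulus_tupleD(2)[OF tup j], symmetric])
      (use annulus_tuple_commute[OF tup _ j] in auto)
qed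

text \<open>Surjectivity is the fixed point theorem for the contraction \<open>x \<mapsto> y + (x - A x)\<close>.\<close>

lemma Neumann_bij:
  fixes A :: "'a::complex_hilbert \<Rightarrow> 'a"
  assumes A: "bounded_clinear A" and near: "\<And>x. norm (x - A x) \<le> c * norm x" and c: "0 \<le> c" "c < 1"
  shows "bij A" and "(1 - c) * norm x \<le> norm (A x)"
proof -
  show lower: "(1 - c) * norm x \<le> norm (A x)" for x
  proof -
    have "norm x \<le> norm (x - A x) + norm (A x)" by (metis diff_add_cancel norm_triangle_ineq)
    with near[of x] show ?thesis by (simp add: algebra_simps)
  qed
  have "inj A"
  proof (rule injI)
    fix x y assume "A x = A y"
    then have "A (x - y) = 0" by (simp add: bounded_clinear_diff[OF A])
    with lower[of "x - y"] c have "norm (x - y) \<le> 0" by (simp add: mult_le_0_iff)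
    then show "x = y" by simp
  qed
  moreover have "surj A"
  proof (rule surjI[of _ "\<lambda>y. SOME x. A x = y"])
    fix y
    have "\<exists>!x. y + (x - A x) = x"
    proof (rule banach_fix_type[OF c])
      show "\<forall>x x'. dist (y + (x - A x)) (y + (x' - A x')) \<le> c * dist x x'"
      proof (intro allI)
        fix x x'
        have "y + (x - A x) - (y + (x' - A x')) = (x - x') - A (x - x')"
          by (simp add: bounded_clinear_diff[OF A])
        then show "dist (y + (x - A x)) (y + (x' - A x')) \<le> c * dist x x'"
          unfolding dist_norm using near by metis
      qed
    qed
    then obtain x where "y + (x - A x) = x" by blast
    then have "A x = y" by (simp add: algebra_simps)
    then show "A (SOME x. A x = y) = y" by (rule someI)
  qed
  ultimately show "bij A" by (simp add: bij_def)
qed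

lemma invertible_op_of_approximate_inverse:
  fixes Q S :: "'a::complex_hilbert \<Rightarrow> 'a"
  assumes Q: "bounded_clinear Q" and S: "bounded_clinear S" and comm: "\<And>x. Q (S x) = S (Q x)"
    and near: "\<And>x. norm (x - Q (S x)) \<le> 1 / 2 * norm x"
  shows "invertible_op Q"
proof -
  have QS: "bounded_clinear (\<lambda>x. Q (S x))" using bounded_clinear_comp[OF Q S] by (simp add: comp_def)
  have bij: "bij (\<lambda>x. Q (S x))" by (rule Neumann_bij(1)[OF QS near]) auto
  have low: "norm x \<le> 2 * norm (Q (S x))" for x
    using Neumann_bij(2)[OF QS near, of x] by simp
  have "inj Q"
  proof (rule injI)
    fix x y assume "Q x = Q y"
    then have "Q (S x) = Q (S y)" by (simp add: comm)
    then show "x = y" using bij by (auto simp: bij_def dest: injD)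
  qed
  moreover have "surj Q" using bij unfolding bij_def surj_def by blast
  ultimately have bQ: "bij Q" by (simp add: bij_def)
  then have inv: "Q (inv Q x) = x" "inv Q (Q x) = x" for x
    by (simp_all add: bij_is_surj surj_f_inv_f bij_is_inj)
  have "bounded_clinear (inv Q)"
  proof (rule bounded_clinearI)
    show "inv Q (x + y) = inv Q x + inv Q y" for x y
      by (metis bounded_clinear_add[OF Q] inv)
    show "inv Q (c *\<^sub>C x) = c *\<^sub>C inv Q x" for c x
      by (metis bounded_clinear_scaleC[OF Q] inv)
    show "norm (inv Q x) \<le> 2 * onorm S * norm x" for x
      using low[of "inv Q x"] bounded_clinear_bounded[OF S, of x] by (simp add: comm inv)
  qed
  with Q bQ show ?thesis by (simp add: invertible_op_def)
qed

lemma holomorphic_poly_eval_coordinate: "(\<lambda>t. poly_eval n q (z(j := t))) holomorphic_on A"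
proof -
  have "(\<lambda>t. (z(j := t)) i) holomorphic_on A" for i by (cases "i = j") auto
  then show ?thesis unfolding poly_eval_def by (intro holomorphic_intros)
qed

text \<open>The reciprocal of \<open>q\<close> is bounded and separately holomorphic on a larger polyannulus, so
  \<open>Laurent_approximation\<close> applies; the relative error is controlled since \<open>q\<close> is bounded on the
  smaller one.\<close>

lemma approximate_reciprocal:
  fixes T :: "nat \<Rightarrow> 'a::complex_hilbert \<Rightarrow> 'a"
  assumes r: "1 < r" and tup: "annulus_tuple r n T"
    and nz: "\<And>z. z \<in> zero_extended_polyannulus n r \<Longrightarrow> poly_eval n q z \<noteq> 0" and "\<eta> > 0"
  obtains h S where "Laurent_calc n T h S"
    "\<And>z. z \<in> polyannulus n r \<Longrightarrow> cmod (1 - poly_eval n q z * h z) \<le> \<eta>"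
proof -
  obtain R \<delta> where R: "r < R" "0 < \<delta>"
    "\<And>z. z \<in> polyannulus n R \<Longrightarrow> \<delta> \<le> cmod (poly_eval n q z)"
    by (rule nonvanishing_polynomial_lower_bound[OF r nz], assumption, rule that)
  obtain B where B: "\<And>z. z \<in> polyannulus n r \<Longrightarrow> cmod (poly_eval n q z) \<le> B" "0 \<le> B"
    by (rule poly_eval_bounded_on_polyannulus, rule that)
  have lower: "\<delta> \<le> cmod (poly_eval n q z)" if "\<And>j. j < n \<Longrightarrow> z j \<in> annulus R" for z
    by (rule R(3)) (use that in \<open>auto simp: polyannulus_def annulus_def inverse_eq_divide intro: less_imp_le\<close>)
  have sep: "bounded_sep_holomorphic n R (1 / \<delta>) (\<lambda>z. 1 / poly_eval n q z)"
    unfolding bounded_sep_holomorphic_def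
  proof (intro conjI allI impI)
    fix z w :: "nat \<Rightarrow> complex" assume "\<forall>j<n. z j = w j"
    then show "1 / poly_eval n q z = 1 / poly_eval n q w" by (metis poly_eval_local)
  next
    fix z :: "nat \<Rightarrow> complex" assume z: "\<forall>j<n. z j \<in> annulus R"
    have low: "\<delta> \<le> cmod (poly_eval n q z)" by (rule lower) (use z in auto)
    then show "cmod (1 / poly_eval n q z) \<le> 1 / \<delta>" using R(2) by (simp add: norm_divide frac_le)
    fix j assume "j < n"
    have "poly_eval n q (z(j := t)) \<noteq> 0" if "t \<in> annulus R" for t
    proof -
      have "\<delta> \<le> cmod (poly_eval n q (z(j := t)))" by (rule lower) (use z that in auto)
      then show ?thesis using R(2) by auto
    qed
    then show "(\<lambda>t. 1 / poly_eval n q (z(j := t))) holomorphic_on annulus R"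
      by (intro holomorphic_intros holomorphic_poly_eval_coordinate) auto
  qed
  have "0 < \<eta> / (B + 1)" using \<open>\<eta> > 0\<close> B(2) by simp
  from Laurent_approximation[OF sep less_imp_le[OF r] R(1) _ tup this] R(2) obtain h S where
    hS: "Laurent_calc n T h S"
      "\<And>z. z \<in> polyannulus n r \<Longrightarrow> cmod (1 / poly_eval n q z - h z) \<le> \<eta> / (B + 1)"
    by auto
  show thesis
  proof (rule that[OF hS(1)])
    fix z assume z: "z \<in> polyannulus n r"
    have "poly_eval n q z \<noteq> 0"
      using nz[OF zero_extended_polyannulus_restrict(1)[OF z]] zero_extended_polyannulus_restrict(2)[OF z, of q] by simp
    then have "1 - poly_eval n q z * h z = poly_eval n q z * (1 / poly_eval n q z - h z)"
      by (simp add: right_diff_distrib)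
    then have "cmod (1 - poly_eval n q z * h z) = cmod (poly_eval n q z) * cmod (1 / poly_eval n q z - h z)"
      by (simp only: norm_mult)
    also have "\<dots> \<le> B * (\<eta> / (B + 1))"
      using z by (intro mult_mono B hS(2)) auto
    also have "\<dots> \<le> \<eta>" using B(2) \<open>\<eta> > 0\<close> by (simp add: field_simps)
    finally show "cmod (1 - poly_eval n q z * h z) \<le> \<eta>" .
  qed
qed

theorem theorem4p3:
  fixes r :: real and n :: nat
    and T :: "nat \<Rightarrow> 'a::complex_hilbert \<Rightarrow> 'a"
    and g :: "cpoly \<times> cpoly"
  assumes "r > 1" and "n \<ge> 1"
    and "doubly_commuting n T"
    and "\<And>j. j < n \<Longrightarrow> invertible_op (T j)"
    and "\<And>j. j < n \<Longrightarrow> onorm (T j) \<le> r"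
    and "\<And>j. j < n \<Longrightarrow> onorm (inv (T j)) \<le> r"
    and "g \<in> Rat_on n (closed_polyannulus n r)"
  shows "invertible_op (poly_op n (snd g) T)
    \<and> onorm (rat_op n g T)
        \<le> ((3 * r\<^sup>2 - 1) / (r\<^sup>2 - 1)) ^ n * sup_norm (closed_polyannulus n r) (rat_eval n g)"
proof -
  obtain p q where g: "g = (p, q)" by (cases g)
  note r = \<open>r > 1\<close>
  have tup: "annulus_tuple r n T" using assms by (simp add: annulus_tuple_def)
  define C where "C = ((3 * r\<^sup>2 - 1) / (r\<^sup>2 - 1)) ^ n"
  have "r\<^sup>2 > 1" using r by (simp add: one_less_power)
  then have C: "C > 0" by (simp add: C_def)
  define P where "P = poly_op n p T"
  define Q where "Q = poly_op n q T"
  have calcP: "Laurent_calc n T (poly_eval n p) P" and calcQ: "Laurent_calc n T (poly_eval n q) Q"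
    unfolding P_def Q_def by (rule Laurent_calc_poly_op[OF tup])+
  have P: "bounded_clinear P" and Q: "bounded_clinear Q"
    using Laurent_calc_bounded_clinear[OF _ tup] calcP calcQ by blast+
  have mem: "restrict z {..<n} \<in> closed_polyannulus n r" if "z \<in> polyannulus n r" for z
    using that by (auto simp: polyannulus_def closed_polyannulus_def closure_annulus[OF r])
  have restr: "poly_eval n p' (restrict z {..<n}) = poly_eval n p' z" for p' z
    by (rule poly_eval_local) simp
  have nzX: "poly_eval n q z \<noteq> 0" if "z \<in> polyannulus n r" for z
    using assms(7) mem[OF that] restr[of q z] by (auto simp: g Rat_on_def)
  have nz: "poly_eval n q z \<noteq> 0" if "z \<in> zero_extended_polyannulus n r" for z
    by (rule nzX) (use that in \<open>auto simp: zero_extended_polyannulus_def polyannulus_def split: if_splits\<close>)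
  define G where "G = sup_norm (closed_polyannulus n r) (rat_eval n g)"
  have G: "cmod (poly_eval n p z) \<le> G * cmod (poly_eval n q z)" if X: "z \<in> polyannulus n r" for z
  proof -
    obtain B where B: "\<And>z. z \<in> polyannulus n r \<Longrightarrow> cmod (poly_eval n p z) \<le> B" "0 \<le> B"
      by (rule poly_eval_bounded_on_polyannulus, rule that)
    obtain R \<delta> where R: "r < R" "0 < \<delta>"
      "\<And>z. z \<in> polyannulus n R \<Longrightarrow> \<delta> \<le> cmod (poly_eval n q z)"
      by (rule nonvanishing_polynomial_lower_bound[OF r nz], assumption, rule that)
    have Rr: "1 / R \<le> 1 / r" using R r by (simp add: frac_le)
    have "bdd_above ((\<lambda>z. cmod (rat_eval n g z)) ` closed_polyannulus n r)"
    proof (rule bdd_aboveI2)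
      fix z assume "z \<in> closed_polyannulus n r"
      then have z: "z \<in> polyannulus n r" by (auto simp: polyannulus_def closed_polyannulus_def closure_annulus[OF r] PiE_iff)
      have "cmod (poly_eval n p z) \<le> B" by (rule B) (use z in auto)
      moreover have "\<delta> \<le> cmod (poly_eval n q z)"
        by (rule R(3)) (use z R Rr in \<open>auto simp: polyannulus_def intro: order_trans\<close>)
      ultimately show "cmod (rat_eval n g z) \<le> B / \<delta>"
        using R(2) B(2) by (simp add: rat_eval_def g norm_divide frac_le)
    qed
    then have "cmod (rat_eval n g (restrict z {..<n})) \<le> G"
      unfolding G_def sup_norm_def by (rule cSUP_upper[OF mem[OF X]])
    then show ?thesis
      using nzX[OF X] by (simp add: rat_eval_def g restr norm_divide divide_le_eq)
  qed
  have G0: "0 \<le> G"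
  proof -
    have X1: "(\<lambda>_. 1) \<in> polyannulus n r" using r by (simp add: polyannulus_def)
    have "0 \<le> G * cmod (poly_eval n q (\<lambda>_. 1))" using G[OF X1] norm_ge_zero order_trans by blast
    then show ?thesis using nzX[OF X1] by (simp add: zero_le_mult_iff)
  qed
  \<comment> \<open>\<open>1 - q h\<close> is itself a Laurent polynomial, so the estimate for the tuple applies to its value \<open>1 - Q S\<close>\<close>
  have approx: "\<exists>h S. Laurent_calc n T h S \<and> (\<forall>z. z \<in> polyannulus n r \<longrightarrow> cmod (1 - poly_eval n q z * h z) \<le> \<eta>)
      \<and> (\<forall>x. norm (x - Q (S x)) \<le> C * \<eta> * norm x)" if eta: "\<eta> > 0" for \<eta>
  proof -
    obtain h S where h: "Laurent_calc n T h S"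
      "\<And>z. z \<in> polyannulus n r \<Longrightarrow> cmod (1 - poly_eval n q z * h z) \<le> \<eta>"
      by (rule approximate_reciprocal[OF r tup nz eta], assumption, rule that)
    have "Laurent_calc n T (\<lambda>z. 1 + (-1) * (poly_eval n q z * h z)) (\<lambda>x. 1 *\<^sub>C x + (-1) *\<^sub>C Q (S x))"
      by (intro Laurent_calc.add Laurent_calc.const Laurent_calc_scale[OF _ tup] Laurent_calc_mult[OF calcQ h(1) tup])
    then have "Laurent_calc n T (\<lambda>z. 1 - poly_eval n q z * h z) (\<lambda>x. x - Q (S x))"
      by (rule Laurent_calc_cong) (auto simp: scaleC_minus_left)
    from Laurent_calc_bound[OF this tup r eta h(2)] have "norm (x - Q (S x)) \<le> C * \<eta> * norm x" for x
      by (simp add: C_def)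
    with h show ?thesis by blast
  qed
  have "1 / (2 * C) > 0" using C by simp
  from approx[OF this] obtain h S where hS: "Laurent_calc n T h S" "\<And>x. norm (x - Q (S x)) \<le> 1 / 2 * norm x"
    using C by auto
  have invQ: "invertible_op Q"
    by (rule invertible_op_of_approximate_inverse[OF Q Laurent_calc_bounded_clinear[OF hS(1) tup] _ hS(2)])
      (rule Laurent_calc_ops_commute[OF calcQ hS(1) tup])
  then have "bij Q" by (simp add: invertible_op_def)
  then have Qinv: "Q (inv Q x) = x" for x by (simp add: bij_is_surj surj_f_inv_f)
  have "norm (P (inv Q x)) \<le> C * G * norm x" for x
  proof (rule field_le_epsilon)
    fix e :: real assume e: "e > 0"
    define y where "y = inv Q x"
    \<comment> \<open>\<open>D - 1\<close> is the factor of \<open>\<eta>\<close> in the error collected below; the \<open>+ 1\<close> keeps it positive\<close>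
    define D where "D = C * (G + 1) * norm x + onorm P * (C * norm y) + 1"
    have "0 \<le> onorm P" using P by (auto simp: bounded_clinear_def onorm_pos_le)
    then have D: "D > 0" using C G0 unfolding D_def by (intro add_nonneg_pos add_nonneg_nonneg mult_nonneg_nonneg) auto
    define \<eta> where "\<eta> = e / D"
    have eta: "\<eta> > 0" "\<eta> * D = e" using e D by (auto simp: \<eta>_def)
    from approx[OF eta(1)] obtain h S where h: "Laurent_calc n T h S"
      "\<And>z. z \<in> polyannulus n r \<Longrightarrow> cmod (1 - poly_eval n q z * h z) \<le> \<eta>" "\<And>x. norm (x - Q (S x)) \<le> C * \<eta> * norm x"
      by blast
    \<comment> \<open>the additional \<open>\<eta>\<close> makes the bound positive when \<open>G = 0\<close>\<close>
    have PS: "norm (P (S x)) \<le> C * (G * (1 + \<eta>) + \<eta>) * norm x"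
      unfolding C_def
    proof (rule Laurent_calc_bound[OF Laurent_calc_mult[OF calcP h(1) tup] tup r])
      show "0 < G * (1 + \<eta>) + \<eta>" using G0 eta by (intro add_nonneg_pos) auto
      fix z assume X: "z \<in> polyannulus n r"
      have "cmod (poly_eval n q z * h z) \<le> cmod 1 + cmod (1 - poly_eval n q z * h z)"
        by (metis norm_minus_commute norm_triangle_sub)
      also have "\<dots> \<le> 1 + \<eta>" using h(2)[OF X] by simp
      finally have qh: "cmod (poly_eval n q z * h z) \<le> 1 + \<eta>" .
      have "cmod (poly_eval n p z * h z) \<le> G * cmod (poly_eval n q z) * cmod (h z)"
        unfolding norm_mult by (rule mult_right_mono[OF G[OF X]]) simp
      also have "\<dots> = G * cmod (poly_eval n q z * h z)" by (simp add: norm_mult)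
      also have "\<dots> \<le> G * (1 + \<eta>)" by (rule mult_left_mono[OF qh G0])
      finally show "cmod (poly_eval n p z * h z) \<le> G * (1 + \<eta>) + \<eta>" using eta by simp
    qed
    have Pd: "norm (P (y - S x)) \<le> onorm P * (C * \<eta> * norm y)"
    proof -
      have "S x = Q (S y)"
        using Laurent_calc_ops_commute[OF calcQ h(1) tup, of y] Qinv[of x] by (simp add: y_def)
      then have "norm (y - S x) \<le> C * \<eta> * norm y" using h(3)[of y] by simp
      then show ?thesis
        using bounded_clinear_bounded[OF P, of "y - S x"] \<open>0 \<le> onorm P\<close> by (meson mult_left_mono order_trans)
    qed
    have Py: "P y = P (S x) + P (y - S x)"
      by (simp add: bounded_clinear_diff[OF P])
    have "norm (P y) \<le> C * (G * (1 + \<eta>) + \<eta>) * norm x + onorm P * (C * \<eta> * norm y)"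
      by (subst Py) (rule order_trans[OF norm_triangle_ineq add_mono[OF PS Pd]])
    also have "\<dots> = C * G * norm x + \<eta> * (D - 1)" by (simp add: D_def algebra_simps)
    also have "\<dots> \<le> C * G * norm x + e" using eta by (simp add: right_diff_distrib)
    finally show "norm (P (inv Q x)) \<le> C * G * norm x + e" by (simp add: y_def)
  qed
  then have "onorm (rat_op n g T) \<le> C * G"
    using C G0 by (intro onorm_bound) (auto simp: rat_op_def g P_def Q_def)
  with invQ show ?thesis by (simp add: g Q_def C_def G_def)
qed

end
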